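(* Let $g:\mathbb{R}^d\to\mathbb{R}$ be continuously differentiable and non-negative with $\|\nabla g(\theta)-\nabla g(\theta')\|\le L\|\theta-\theta'\|$ for all $\theta,\theta'\in\mathbb{R}^d$. Let $\{\theta_n\}_{n\ge1}$ and $\{S_n\}_{n\ge 0}$ be generated by AdaGrad-Norm, and suppose that for all $n\ge 1$: (i) $\mathbb{E}[\nabla g(\theta_n,\xi_n)\mid\mathscr{F}_{n-1}]=\nabla g(\theta_n)$; (ii) $\mathbb{E}[\|\nabla g(\theta_n,\xi_n)\|^2\mid\mathscr{F}_{n-1}]\le\sigma_0\|\nabla g(\theta_n)\|^2+\sigma_1$ for some constants $\sigma_0,\sigma_1\ge0$. Then for any initial point $\theta_1\in\mathbb{R}^d$ and any $S_0>0$, $$\mathbb{E}[S_T]=\mathcal{O}(T).$$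
   Context: AdaGrad-Norm: given an initial point $\theta_1\in\mathbb{R}^d$ and constants $S_0>0$, $\alpha_0>0$, for $n\ge1$ $$S_n=S_{n-1}+\|\nabla g(\theta_n,\xi_n)\|^2,\qquad \theta_{n+1}=\theta_n-\frac{\alpha_0}{\sqrt{S_n}}\nabla g(\theta_n,\xi_n).$$ Here $\{\xi_n\}_{n\ge1}$ is a sequence of independent random variables and $\nabla g(\theta_n,\xi_n)\in\mathbb{R}^d$ is the random vector (stochastic gradient) returned by a stochastic first-order oracle at $\theta_n$ with noise $\xi_n$. The filtration is $\mathscr{F}_n=\sigma\{\theta_1,\xi_1,\dots,\xi_n\}$ for $n\ge1$ and $\mathscr{F}_0=\{\emptyset,\Omega\}$. The $\mathcal{O}(\cdot)$ is as $T\to\infty$, with a hidden constant independent of $T$. *)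

theory Defs
  imports "HOL-Probability.Probability" "HOL-Library.Landau_Symbols"
begin

(* The stochastic gradient is a function sg of the point and of the noise value, so that
   sg (\<theta> n \<omega>) (\<xi> n \<omega>) is the oracle's answer at step n.  The iterates are indexed from 1
   (\<theta> 0 is unconstrained); the initial data \<theta>1 and S0 are deterministic. *)
definition adagrad_norm ::
  "'w measure \<Rightarrow> ('a::euclidean_space \<Rightarrow> 'b \<Rightarrow> 'a) \<Rightarrow> (nat \<Rightarrow> 'w \<Rightarrow> 'b) \<Rightarrow> real \<Rightarrow> 'a \<Rightarrow> real
    \<Rightarrow> (nat \<Rightarrow> 'w \<Rightarrow> 'a) \<Rightarrow> (nat \<Rightarrow> 'w \<Rightarrow> real) \<Rightarrow> bool"
where
  "adagrad_norm M sg \<xi> \<alpha>0 \<theta>1 S0 \<theta> S \<longleftrightarrow>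
     (\<forall>\<omega>\<in>space M.
        \<theta> 1 \<omega> = \<theta>1 \<and> S 0 \<omega> = S0 \<and>
        (\<forall>n\<ge>1.
           S n \<omega> = S (n - 1) \<omega> + (norm (sg (\<theta> n \<omega>) (\<xi> n \<omega>)))\<^sup>2 \<and>
           \<theta> (n + 1) \<omega> = \<theta> n \<omega> - (\<alpha>0 / sqrt (S n \<omega>)) *\<^sub>R sg (\<theta> n \<omega>) (\<xi> n \<omega>)))"

definition noise_filtration ::
  "'w measure \<Rightarrow> 'b measure \<Rightarrow> ('w \<Rightarrow> 'a::euclidean_space) \<Rightarrow> (nat \<Rightarrow> 'w \<Rightarrow> 'b) \<Rightarrow> nat \<Rightarrow> 'w measure"
where
  "noise_filtration M N X \<xi> n = sigma (space M)
     (if n = 0 then {}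
      else {X -` A \<inter> space M |A. A \<in> sets borel} \<union>
           {\<xi> i -` B \<inter> space M |i B. i \<in> {1..n} \<and> B \<in> sets N})"

(* The library provides conditional expectations of real-valued functions only; for a
   vector-valued function the conditional expectation is taken coordinatewise. *)
definition vec_cond_exp ::
  "'w measure \<Rightarrow> 'w measure \<Rightarrow> ('w \<Rightarrow> 'a::euclidean_space) \<Rightarrow> 'w \<Rightarrow> 'a"
where
  "vec_cond_exp M F X \<omega> = (\<Sum>b\<in>Basis. real_cond_exp M F (\<lambda>\<omega>'. X \<omega>' \<bullet> b) \<omega> *\<^sub>R b)"

end

theory Submission
  imports Defs
begin

text \<open>
Since \<open>S\<close> grows by squared oracle answers, the second moment hypothesis reduces the claim to
\<open>\<Sum>\<^sub>n\<^sub>\<le>\<^sub>T E \<parallel>grad (\<theta>\<^sub>n)\<parallel>\<^sup>2 = O(T)\<close>. Write \<open>G\<close> for the oracle's answer at a point \<open>\<theta>\<close>,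
\<open>\<Gamma> = \<parallel>G\<parallel>\<^sup>2\<close>, \<open>S\<close> for the accumulated sum before the step, \<open>S' = S + \<Gamma>\<close>, \<open>\<eta> = \<parallel>grad \<theta>\<parallel>\<^sup>2\<close>,
\<open>p = grad \<theta> \<bullet> G\<close>, and \<open>u\<close>, \<open>v\<close> for the values of \<open>g + 1\<close> before and after the step. The shift by \<open>1\<close>
makes lower powers of \<open>u\<close> smaller than higher ones, and \<open>\<eta> \<le> 4 L u\<close> because \<open>g\<close> is nonnegative
and smooth.

Multiplying the descent inequality by \<open>sqrt S'\<close> removes the random step size from its linear term:
\<open>sqrt S' * v - sqrt S * u \<le> - \<alpha>\<^sub>0 p + K u (sqrt S' - sqrt S)\<close>. The mean of \<open>p\<close> is that of \<open>\<eta>\<close>, so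
only the last term is in the way. If \<open>u\<close> is at most a small multiple of \<open>sqrt S'\<close>, it is a small
multiple of \<open>\<Gamma>\<close>, which the second moment bound turns into a small multiple of \<open>\<eta>\<close> plus a constant.
Otherwise powers of \<open>u / sqrt S'\<close> can be inserted for free, and the term is at most a multiple of
\<open>u\<^sup>4 (1/S - 1/S')\<close>.

That quantity is controlled by the second potential \<open>u\<^sup>4 / S\<close>: its decreasing weight loses exactly
\<open>u\<^sup>4 (1/S - 1/S')\<close> in each step, while every other contribution is of lower order in \<open>u\<close> and times the
same difference \<open>1/S - 1/S'\<close>, hence absorbed up to \<open>const * (1/S - 1/S')\<close>, which telescopes. The
one exception is the linear term, where \<open>p\<close> is correlated with \<open>S'\<close>. If \<open>\<eta> \<le> 16 S\<close>
(lemma \<open>flat_drift\<close>), replacing \<open>S'\<close> by \<open>S\<close> costs an error which the second moment bound controls.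
If \<open>\<eta> > 16 S\<close> (lemma \<open>steep_drift\<close>), an answer with mean \<open>grad \<theta>\<close> and second moment of order \<open>\<eta>\<close> must
have \<open>\<Gamma> \<ge> S\<close> with a probability bounded below; the weight is then at least halved, and this pays even
for the crudest bound on \<open>v\<close>.

All these estimates are pointwise inequalities in which the conditional distribution of \<open>G\<close> enters
only through two correction terms \<open>Z\<^sub>1 (\<eta> - p)\<close> and \<open>Z\<^sub>2 (\<Gamma> - \<sigma>\<^sub>0 \<eta> - \<sigma>\<^sub>1)\<close>, with \<open>Z\<^sub>1\<close> and \<open>Z\<^sub>2 \<ge> 0\<close>
functions of the past (lemma \<open>adagrad_lyapunov_drift\<close>). Their expectations are zero and at most
zero, so the potential \<open>sqrt S * u + c (u\<^sup>4 + K) / S\<close> loses \<open>\<alpha>\<^sub>0/2 * E \<eta>\<close> per step up to a constant.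
Summation over the steps gives the theorem. Integrability is never an issue, because a step is never
longer than \<open>\<alpha>\<^sub>0\<close>: for each \<open>n\<close> the iterate \<open>\<theta>\<^sub>n\<close> stays in a fixed ball.
\<close>

section \<open>Functions with a Lipschitz continuous gradient\<close>

lemma gradient_lipschitz_remainder:
  fixes g :: "'a::euclidean_space \<Rightarrow> real"
  assumes der: "\<And>x. GDERIV g x :> grad x"
    and lip: "\<And>x y. norm (grad x - grad y) \<le> L * norm (x - y)"
    and L: "L \<ge> 0"
  shows "\<bar>g (x + h) - g x - grad x \<bullet> h\<bar> \<le> L * (norm h)\<^sup>2"
proof -
  let ?\<phi> = "\<lambda>t. g (x + t *\<^sub>R h)"
  have der\<phi>: "(?\<phi> has_field_derivative grad (x + t *\<^sub>R h) \<bullet> h) (at t)" for t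
  proof -
    have *: "(g has_derivative (\<lambda>k. grad (x + t *\<^sub>R h) \<bullet> k)) (at (x + t *\<^sub>R h))"
      using der[of "x + t *\<^sub>R h"] by (simp add: gderiv_def inner_commute)
    have "((\<lambda>t. g (x + t *\<^sub>R h)) has_derivative (\<lambda>k. grad (x + t *\<^sub>R h) \<bullet> (k *\<^sub>R h))) (at t)"
      by (rule has_derivative_compose[where f = "\<lambda>t. x + t *\<^sub>R h", OF _ *])
        (auto intro!: derivative_eq_intros)
    then show ?thesis
      by (simp add: has_field_derivative_def mult_commute_abs)
  qed
  obtain t where t: "0 < t" "t < 1" "?\<phi> 1 - ?\<phi> 0 = (1 - 0) * (grad (x + t *\<^sub>R h) \<bullet> h)"
    using MVT2[of 0 1 ?\<phi> "\<lambda>t. grad (x + t *\<^sub>R h) \<bullet> h"] der\<phi> by auto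
  have "g (x + h) - g x - grad x \<bullet> h = (grad (x + t *\<^sub>R h) - grad x) \<bullet> h"
    using t by (simp add: inner_diff_left)
  also have "\<bar>\<dots>\<bar> \<le> norm (grad (x + t *\<^sub>R h) - grad x) * norm h"
    by (rule Cauchy_Schwarz_ineq2)
  also have "\<dots> \<le> (L * norm h) * norm h"
  proof (rule mult_right_mono)
    have "norm (grad (x + t *\<^sub>R h) - grad x) \<le> L * norm (t *\<^sub>R h)"
      using lip[of "x + t *\<^sub>R h" x] by simp
    also have "\<dots> \<le> L * norm h"
      using t L by (intro mult_left_mono) (auto simp: mult_left_le_one_le)
    finally show "norm (grad (x + t *\<^sub>R h) - grad x) \<le> L * norm h" .
  qed simp
  finally show ?thesis by (simp add: power2_eq_square mult.assoc)
qed

text \<open>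
A gradient step of length \<open>1 / (2 L)\<close> lowers the value by at least \<open>\<parallel>grad x\<parallel>\<^sup>2 / (4 L)\<close>, and the value
cannot become negative.
\<close>

lemma gradient_norm_le_value:
  fixes g :: "'a::euclidean_space \<Rightarrow> real"
  assumes der: "\<And>x. GDERIV g x :> grad x"
    and lip: "\<And>x y. norm (grad x - grad y) \<le> L * norm (x - y)"
    and L: "L > 0"
    and nonneg: "\<And>x. g x \<ge> 0"
  shows "(norm (grad x))\<^sup>2 \<le> 4 * L * g x"
proof -
  let ?h = "- (1 / (2 * L)) *\<^sub>R grad x"
  have "\<bar>g (x + ?h) - g x - grad x \<bullet> ?h\<bar> \<le> L * (norm ?h)\<^sup>2"
    by (rule gradient_lipschitz_remainder[OF der lip]) (use L in auto)
  moreover have "grad x \<bullet> ?h = - (norm (grad x))\<^sup>2 / (2 * L)"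
    by (simp add: power2_norm_eq_inner)
  moreover have "L * (norm ?h)\<^sup>2 = (norm (grad x))\<^sup>2 / (4 * L)"
    using L by (simp add: power_mult_distrib power_divide field_simps power2_eq_square)
  ultimately have "0 \<le> g x - (norm (grad x))\<^sup>2 / (2 * L) + (norm (grad x))\<^sup>2 / (4 * L)"
    using nonneg[of "x + ?h"] by linarith
  then show ?thesis using L by (simp add: field_simps)
qed

section \<open>Pointwise drift of the potentials\<close>

text \<open>
Here \<open>p\<close> stands for \<open>p / sqrt S'\<close> and \<open>q\<close> for \<open>\<Gamma> / S'\<close>. An increment \<open>d = v - u\<close> satisfies
\<open>d\<^sup>2 \<le> const * u q\<close>, so that the terms of order two and higher in \<open>d\<close> are at most \<open>const * u\<^sup>3 q\<close>:
one power of \<open>u\<close> below the leading term.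
\<close>

lemma quartic_increment:
  fixes u v \<alpha> p q A B :: real
  assumes u: "u \<ge> 1" and q: "0 \<le> q" "q \<le> 1"
    and step: "\<bar>v - u + \<alpha> * p\<bar> \<le> A * q" and p: "p\<^sup>2 \<le> B * u * q"
  shows "v ^ 4 \<le> u ^ 4 - 4 * \<alpha> * u ^ 3 * p + (4 * A + 16 * (\<alpha>\<^sup>2 * B + A\<^sup>2) + 12 * (\<alpha>\<^sup>2 * B + A\<^sup>2)\<^sup>2) * u ^ 3 * q"
proof -
  define d where "d = v - u"
  define K where "K = \<alpha>\<^sup>2 * B + A\<^sup>2"
  have d1: "d \<le> - \<alpha> * p + A * q" using step unfolding d_def by linarith
  have uq: "u * q \<ge> 0" "u * q \<ge> q" "q\<^sup>2 \<le> u * q"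
    using u q mult_right_mono[of 1 u q] mult_right_mono[of q 1 q] by (auto simp: power2_eq_square)
  have "d\<^sup>2 = ((d + \<alpha> * p) - \<alpha> * p)\<^sup>2" by simp
  also have "\<dots> \<le> 2 * (d + \<alpha> * p)\<^sup>2 + 2 * (\<alpha> * p)\<^sup>2"
    using zero_le_power2[of "d + 2 * (\<alpha> * p)"] by (simp add: power2_eq_square algebra_simps)
  also have "(d + \<alpha> * p)\<^sup>2 \<le> (A * q)\<^sup>2"
    using step unfolding d_def by (metis abs_ge_zero power2_abs power_mono)
  also have "(A * q)\<^sup>2 \<le> A\<^sup>2 * (u * q)"
    using uq by (simp add: power_mult_distrib mult_left_mono)
  also have "(\<alpha> * p)\<^sup>2 \<le> \<alpha>\<^sup>2 * (B * u * q)"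
    using p by (simp add: power_mult_distrib mult_left_mono)
  finally have d2: "d\<^sup>2 \<le> 2 * K * (u * q)" unfolding K_def by (simp add: algebra_simps)
  have "0 \<le> 2 * K * (u * q)" using d2 zero_le_power2[of d] by linarith
  have K2: "2 * K * (u * q) * (2 * K * (u * q)) = 4 * K\<^sup>2 * (u\<^sup>2 * q\<^sup>2)" 
    by (simp add: power2_eq_square)
  have "d ^ 4 = d\<^sup>2 * d\<^sup>2" by (simp add: power_numeral_reduce)
  also have "\<dots> \<le> 2 * K * (u * q) * (2 * K * (u * q))"
    using d2 \<open>0 \<le> 2 * K * (u * q)\<close> by (intro mult_mono) auto
  also have "\<dots> = 4 * K\<^sup>2 * (u\<^sup>2 * q\<^sup>2)" by (rule K2)
  also have "\<dots> \<le> 4 * K\<^sup>2 * (u\<^sup>2 * (u * q))"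
    using uq by (intro mult_left_mono) auto
  finally have d4: "d ^ 4 \<le> 4 * K\<^sup>2 * (u ^ 3 * q)" by (simp add: power_numeral_reduce algebra_simps)
  have "v ^ 4 = (u + d) ^ 4" by (simp add: d_def)
  also have "\<dots> = u ^ 4 + 4 * u ^ 3 * d + 6 * (u\<^sup>2 * d\<^sup>2) + 4 * (u * d) * d\<^sup>2 + d ^ 4"
    by (simp add: power_numeral_reduce algebra_simps)
  also have "4 * (u * d) * d\<^sup>2 \<le> 2 * (u\<^sup>2 * d\<^sup>2) + 2 * d ^ 4"
    using sum_squares_bound[of "u * d" "d\<^sup>2"] by (simp add: power_numeral_reduce algebra_simps)
  finally have "v ^ 4 \<le> u ^ 4 + 4 * u ^ 3 * d + 8 * (u\<^sup>2 * d\<^sup>2) + 3 * d ^ 4"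
    by (simp add: algebra_simps)
  also have "4 * u ^ 3 * d \<le> 4 * u ^ 3 * (- \<alpha> * p + A * q)"
    using d1 u by (intro mult_left_mono) auto
  also have "u\<^sup>2 * d\<^sup>2 \<le> u\<^sup>2 * (2 * K * (u * q))"
    using d2 by (intro mult_left_mono) auto
  also note d4
  finally show ?thesis unfolding K_def[symmetric] by (simp add: power_numeral_reduce algebra_simps)
qed

lemma lower_power_absorb:
  fixes c s :: real
  assumes "s \<ge> 0" "c \<ge> 0"
  shows "c * s ^ 7 \<le> s ^ 8 / 2 + c * (2 * c) ^ 7"
proof (cases "s \<ge> 2 * c")
  case True
  then have "2 * c * s ^ 7 \<le> s * s ^ 7" using assms by (intro mult_right_mono) auto
  moreover have "s * s ^ 7 = s ^ 8" by (simp add: power_numeral_reduce)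
  moreover have "0 \<le> c * (2 * c) ^ 7" using assms by simp
  ultimately show ?thesis by linarith
next
  case False
  then have "c * s ^ 7 \<le> c * (2 * c) ^ 7" using assms by (intro mult_left_mono power_mono) auto
  moreover have "s ^ 8 \<ge> 0" by simp
  ultimately show ?thesis by linarith
qed

text \<open>
A pointwise form of the statement that \<open>\<Gamma> / (S + \<Gamma>)\<close> has conditional mean at least \<open>1 / (4 m)\<close>: the
other two summands have conditional mean at most \<open>0\<close> once \<open>p\<close> and \<open>\<Gamma>\<close> have conditional means \<open>\<eta>\<close> and
at most \<open>\<rho>\<close>. If \<open>\<Gamma> \<le> \<eta> / 16\<close> then \<open>p\<close> falls short of \<open>\<eta>\<close> by a fixed fraction and the second summand
is large; otherwise \<open>\<Gamma> \<ge> S\<close> by the choice of the constant \<open>16\<close>, and the first summand is large.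
\<close>

lemma jump_detection:
  fixes S \<eta> \<Gamma> p \<rho> m :: real
  assumes S: "S > 0" and \<eta>: "\<eta> > 16 * S" and \<Gamma>: "\<Gamma> \<ge> 0" and p: "p\<^sup>2 \<le> \<eta> * \<Gamma>"
    and m: "\<rho> \<le> m * \<eta>" "m > 0"
  shows "1 \<le> 4 * m * (\<Gamma> / (S + \<Gamma>)) + 2 * (\<eta> - p) / \<eta> + (\<Gamma> - \<rho>) / (2 * m * \<eta>)"
proof -
  define x where "x = sqrt (\<Gamma> / \<eta>)"
  have \<eta>0: "\<eta> > 0" using S \<eta> by linarith
  have x0: "x \<ge> 0" and x2: "x\<^sup>2 = \<Gamma> / \<eta>"
    using \<Gamma> \<eta>0 by (auto simp: x_def)
  have "p \<le> sqrt (\<eta> * \<Gamma>)" using p by (rule real_le_rsqrt)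
  also have "\<dots> = \<eta> * x"
    using \<eta>0 by (simp add: x_def real_sqrt_mult real_sqrt_divide field_simps)
  finally have "2 * (\<eta> - p) / \<eta> \<ge> 2 - 2 * x"
    using \<eta>0 by (simp add: field_simps)
  moreover have "(\<Gamma> - \<rho>) / (2 * m * \<eta>) \<ge> x\<^sup>2 / (2 * m) - 1 / 2"
    using \<eta>0 m by (simp add: x2 field_simps)
  moreover have "1 \<le> 4 * m * (\<Gamma> / (S + \<Gamma>)) + (2 - 2 * x) + (x\<^sup>2 / (2 * m) - 1 / 2)"
  proof (cases "x \<le> 1 / 4")
    case True
    moreover have "4 * m * (\<Gamma> / (S + \<Gamma>)) \<ge> 0" "x\<^sup>2 / (2 * m) \<ge> 0" using m S \<Gamma> by auto
    ultimately show ?thesis by linarith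
  next
    case False
    then have "x\<^sup>2 \<ge> (1 / 4)\<^sup>2" by (intro power_mono) auto
    then have "\<Gamma> / \<eta> \<ge> 1 / 16" by (simp only: x2) (simp add: power2_eq_square)
    then have "\<Gamma> \<ge> S" using \<eta> \<eta>0 by (simp add: field_simps)
    then have "4 * m * (\<Gamma> / (S + \<Gamma>)) \<ge> 4 * m * (1 / 2)"
      using S m by (intro mult_left_mono) (auto simp: field_simps)
    moreover have "2 * x \<le> x\<^sup>2 / (2 * m) + 2 * m"
      using m zero_le_power2[of "x - 2 * m"] by (simp add: field_simps power2_eq_square)
    ultimately show ?thesis by linarith
  qed
  ultimately show ?thesis by linarith
qed

text \<open>
The crude bound of \<open>v\<^sup>4 - u\<^sup>4\<close> by \<open>const * u powr (7/2)\<close> leaves an error without the factor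
\<open>1/S - 1/S'\<close>. Lemma \<open>jump_detection\<close>, multiplied by this error, supplies the factor, up to the two
corrections. The square root \<open>s\<close> of \<open>u\<close> avoids half-integer exponents.
\<close>

lemma steep_drift:
  fixes S \<eta> \<Gamma> p \<rho> m \<alpha> B u v s C1 :: real
  defines "C2 \<equiv> 4 * \<alpha> * sqrt B + C1"
  assumes S: "S > 0" and \<eta>: "\<eta> > 16 * S" and \<Gamma>: "\<Gamma> \<ge> 0" and p: "p\<^sup>2 \<le> \<eta> * \<Gamma>"
    and m: "\<rho> \<le> m * \<eta>" "m > 0" and s: "s \<ge> 1" "u = s\<^sup>2" and \<eta>B: "\<eta> \<le> B * u"
    and \<alpha>: "\<alpha> \<ge> 0" and B: "B \<ge> 0" and C1: "C1 \<ge> 0"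
    and quartic: "v ^ 4 \<le> u ^ 4 - 4 * \<alpha> * u ^ 3 * (p / sqrt (S + \<Gamma>)) + C1 * u ^ 3 * (\<Gamma> / (S + \<Gamma>))"
  shows "v ^ 4 / (S + \<Gamma>) \<le> u ^ 4 / S - u ^ 4 * (1 / S - 1 / (S + \<Gamma>))
    + 4 * m * C2 * s ^ 7 * (1 / S - 1 / (S + \<Gamma>))
    + 2 * C2 * s ^ 7 / (S * \<eta>) * (\<eta> - p) + C2 * s ^ 7 / (2 * m * \<eta> * S) * (\<Gamma> - \<rho>)"
proof -
  let ?S = "S + \<Gamma>"
  have pos: "?S > 0" "\<eta> > 0" "u \<ge> 1" using S \<Gamma> \<eta> s by (auto simp: power2_eq_square mult_ge1_I)
  have C2: "C2 \<ge> 0" unfolding C2_def using \<alpha> B C1 by simp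
  have q: "\<Gamma> / ?S \<le> 1" "0 \<le> \<Gamma> / ?S" using S \<Gamma> by auto
  have "(p / sqrt ?S)\<^sup>2 = p\<^sup>2 / ?S" using pos by (simp add: power_divide)
  also have "\<dots> \<le> \<eta> * (\<Gamma> / ?S)" using p pos by (simp add: divide_right_mono)
  also have "\<dots> \<le> \<eta> * 1" using q pos by (intro mult_left_mono) auto
  also have "\<dots> \<le> B * u" using \<eta>B by simp
  also have "\<dots> = (sqrt B * s)\<^sup>2" using B s by (simp add: power_mult_distrib)
  finally have "\<bar>p / sqrt ?S\<bar> \<le> sqrt B * s" using B s by (subst power2_le_iff_abs_le[symmetric]) auto
  then have "- (p / sqrt ?S) \<le> sqrt B * s" by linarith
  then have "4 * \<alpha> * u ^ 3 * (- (p / sqrt ?S)) \<le> 4 * \<alpha> * u ^ 3 * (sqrt B * s)"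
    using \<alpha> pos by (intro mult_left_mono) auto
  moreover have "\<Gamma> / ?S \<le> s" using q s by linarith
  then have "C1 * u ^ 3 * (\<Gamma> / ?S) \<le> C1 * u ^ 3 * s"
    using C1 pos by (intro mult_left_mono) auto
  moreover have "4 * \<alpha> * u ^ 3 * (sqrt B * s) + C1 * u ^ 3 * s = C2 * s ^ 7"
    unfolding C2_def s by (simp add: power_numeral_reduce algebra_simps)
  ultimately have "v ^ 4 \<le> u ^ 4 + C2 * s ^ 7" using quartic by linarith
  then have "v ^ 4 / ?S \<le> (u ^ 4 + C2 * s ^ 7) / ?S" using pos by (intro divide_right_mono) auto
  also have "\<dots> = u ^ 4 / ?S + C2 * s ^ 7 / ?S" by (rule add_divide_distrib)
  also have "C2 * s ^ 7 / ?S \<le> C2 * s ^ 7 / S * 1"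
    using S \<Gamma> C2 s by (simp add: divide_left_mono)
  also have "C2 * s ^ 7 / S * 1 \<le> C2 * s ^ 7 / S *
      (4 * m * (\<Gamma> / ?S) + 2 * (\<eta> - p) / \<eta> + (\<Gamma> - \<rho>) / (2 * m * \<eta>))"
    using jump_detection[OF S \<eta> \<Gamma> p m] S C2 s by (intro mult_left_mono) auto
  also have "\<dots> = 4 * m * C2 * s ^ 7 * (\<Gamma> / ?S / S)
      + 2 * C2 * s ^ 7 / (S * \<eta>) * (\<eta> - p) + C2 * s ^ 7 / (2 * m * \<eta> * S) * (\<Gamma> - \<rho>)"
    by (simp add: distrib_left mult_ac)
  also have "\<Gamma> / ?S / S = 1 / S - 1 / ?S" using S pos by (simp add: field_simps)
  also have "u ^ 4 / ?S = u ^ 4 / S - u ^ 4 * (1 / S - 1 / ?S)" by (simp add: algebra_simps)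
  finally show ?thesis by simp
qed

text \<open>
With \<open>q = \<Gamma> / S'\<close>, replacing the weight \<open>1 / (S' sqrt S')\<close> of \<open>p\<close> by the predictable weight \<open>1 / (S sqrt S)\<close>
costs at most \<open>2 q sqrt (\<eta> \<Gamma>) / (S sqrt S)\<close>. The Young inequality
\<open>2 q sqrt (\<eta> \<Gamma>) \<le> \<eta> \<Gamma> / \<rho> + \<rho> q\<^sup>2\<close> is balanced so that the mean of \<open>\<eta> \<Gamma> / \<rho>\<close> is at most the
\<open>\<eta>\<close> supplied by the linear term. For the other part, \<open>\<eta> \<le> 16 S\<close> and \<open>\<eta> \<le> B u\<close> together give
\<open>\<eta> \<le> const * sqrt (S u)\<close>, so that \<open>Y \<rho> q\<^sup>2\<close> is of order \<open>u powr (7/2) * (1/S - 1/S')\<close>.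
\<close>

lemma flat_drift:
  fixes S \<eta> \<Gamma> p \<alpha> B u v s C1 \<sigma>0 \<sigma>1 S0 :: real
  defines "\<rho> \<equiv> \<sigma>0 * \<eta> + \<sigma>1" and "Y \<equiv> 4 * \<alpha> * u ^ 3 / (S * sqrt S)"
  assumes S: "S \<ge> S0" "S0 > 0" and \<eta>: "\<eta> \<le> 16 * S" "\<eta> \<ge> 0" and \<Gamma>: "\<Gamma> \<ge> 0" and p: "p\<^sup>2 \<le> \<eta> * \<Gamma>"
    and \<sigma>: "\<sigma>0 \<ge> 0" "\<sigma>1 > 0" and s: "s \<ge> 1" "u = s\<^sup>2" and \<eta>B: "\<eta> \<le> B * u"
    and \<alpha>: "\<alpha> \<ge> 0" and B: "B \<ge> 0" and C1: "C1 \<ge> 0"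
    and quartic: "v ^ 4 \<le> u ^ 4 - 4 * \<alpha> * u ^ 3 * (p / sqrt (S + \<Gamma>)) + C1 * u ^ 3 * (\<Gamma> / (S + \<Gamma>))"
  shows "v ^ 4 / (S + \<Gamma>) \<le> u ^ 4 / S - u ^ 4 * (1 / S - 1 / (S + \<Gamma>))
    + (4 * \<alpha> * (4 * \<sigma>0 * sqrt B + \<sigma>1 / sqrt S0) + C1) * s ^ 7 * (1 / S - 1 / (S + \<Gamma>))
    + Y * (\<eta> - p) + Y * \<eta> / \<rho> * (\<Gamma> - \<rho>)"
proof -
  let ?S = "S + \<Gamma>"
  let ?D = "1 / S - 1 / (S + \<Gamma>)"
  define q where "q = \<Gamma> / ?S"
  have pos: "S > 0" "?S > 0" "u \<ge> 1" using S \<Gamma> s by (auto simp: power2_eq_square mult_ge1_I)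
  have \<rho>: "\<rho> > 0" unfolding \<rho>_def using \<sigma> \<eta> by (simp add: add_nonneg_pos)
  have Y: "Y \<ge> 0" unfolding Y_def using \<alpha> pos by simp
  have q: "0 \<le> q" "q \<le> 1" unfolding q_def using pos \<Gamma> by auto
  have D: "?D = q / S" "?D \<ge> 0" using pos \<Gamma> by (auto simp: q_def field_simps)

  define x where "x = S / ?S"
  have x: "0 < x" "x \<le> 1" "1 - x = q" unfolding x_def q_def using pos \<Gamma> by (auto simp: field_simps)
  (* 1 - x^(3/2) is at most 1 - x^2, which is at most 2 (1 - x). *)
  have "x * x \<le> x * sqrt x" using x by (intro mult_left_mono) (auto simp: real_le_rsqrt power2_eq_square mult_left_le)
  moreover have "1 - x * x \<le> 2 * (1 - x)"
    using zero_le_power2[of "1 - x"] by (simp add: power2_eq_square algebra_simps)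
  moreover have "x * sqrt x \<le> 1" using x by (intro mult_le_one) auto
  ultimately have x32: "1 - x * sqrt x \<le> 2 * q" "0 \<le> 1 - x * sqrt x"
    unfolding x(3)[symmetric] by linarith+
  have absp: "\<bar>p\<bar> \<le> sqrt (\<eta> * \<Gamma>)" using p by (metis real_sqrt_abs real_sqrt_le_iff)
  have xsqrt: "x * sqrt x = (S * sqrt S) / (?S * sqrt ?S)"
    by (simp add: x_def real_sqrt_divide)
  have "Y * p * (x * sqrt x) = 4 * \<alpha> * u ^ 3 * (p / sqrt ?S) / ?S"
    unfolding xsqrt Y_def using pos by simp
  then have split_p: "4 * \<alpha> * u ^ 3 * (p / sqrt ?S) / ?S = Y * p - Y * p * (1 - x * sqrt x)"
    by (simp add: algebra_simps)
  have "Y * p * (1 - x * sqrt x) \<le> Y * (sqrt (\<eta> * \<Gamma>) * (2 * q))"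
    unfolding mult.assoc using Y absp x32 \<eta> \<Gamma> by (intro mult_left_mono mult_mono) auto
  also have "sqrt (\<eta> * \<Gamma>) * (2 * q) = 2 * sqrt (\<eta> * \<Gamma> / \<rho>) * (sqrt \<rho> * q)"
    using \<rho> by (simp add: real_sqrt_divide)
  also have "\<dots> \<le> (sqrt (\<eta> * \<Gamma> / \<rho>))\<^sup>2 + (sqrt \<rho> * q)\<^sup>2"
    by (rule sum_squares_bound)
  also have "\<dots> = \<eta> * \<Gamma> / \<rho> + \<rho> * q * q"
    using \<rho> \<eta> \<Gamma> by (simp add: power_mult_distrib) (simp add: power2_eq_square)
  also have "\<dots> \<le> \<eta> * \<Gamma> / \<rho> + \<rho> * q * 1"
    using q \<rho> by (intro add_left_mono mult_left_mono) auto
  finally have err: "Y * p * (1 - x * sqrt x) \<le> Y * (\<eta> * \<Gamma> / \<rho> + \<rho> * q)"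
    using Y by (simp add: mult_left_mono)

  have "\<eta>\<^sup>2 = \<eta> * \<eta>" by (rule power2_eq_square)
  also have "\<dots> \<le> 16 * S * (B * u)" using \<eta> \<eta>B pos by (intro mult_mono) auto
  also have "\<dots> = (4 * sqrt B * s * sqrt S)\<^sup>2" using B s pos by (simp add: power_mult_distrib)
  finally have "\<eta> \<le> 4 * sqrt B * s * sqrt S"
    by (rule power2_le_imp_le) (use B s pos in auto)
  then have "\<sigma>0 * (\<eta> / sqrt S) \<le> \<sigma>0 * (4 * sqrt B * s)"
    using \<sigma> pos by (intro mult_left_mono) (auto simp: field_simps)
  moreover have "\<sigma>1 / sqrt S \<le> \<sigma>1 / sqrt S0" using S \<sigma> by (intro divide_left_mono) auto
  moreover have "\<sigma>1 / sqrt S0 * 1 \<le> \<sigma>1 / sqrt S0 * s" using \<sigma> S s by (intro mult_left_mono) auto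
  ultimately have \<rho>S: "\<rho> / sqrt S \<le> (4 * \<sigma>0 * sqrt B + \<sigma>1 / sqrt S0) * s"
    unfolding \<rho>_def by (simp add: add_divide_distrib algebra_simps)
  have "Y * (\<rho> * q) = 4 * \<alpha> * u ^ 3 * (\<rho> / sqrt S) * ?D"
    unfolding D Y_def by (simp add: mult_ac)
  also have "\<dots> \<le> 4 * \<alpha> * u ^ 3 * ((4 * \<sigma>0 * sqrt B + \<sigma>1 / sqrt S0) * s) * ?D"
    using \<rho>S \<alpha> pos D by (intro mult_left_mono mult_right_mono) auto
  also have "\<dots> = 4 * \<alpha> * (4 * \<sigma>0 * sqrt B + \<sigma>1 / sqrt S0) * s ^ 7 * ?D"
    unfolding s by (simp add: power_numeral_reduce algebra_simps)
  finally have Y\<rho>: "Y * (\<rho> * q) \<le> 4 * \<alpha> * (4 * \<sigma>0 * sqrt B + \<sigma>1 / sqrt S0) * s ^ 7 * ?D" .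

  have "C1 * u ^ 3 * q / ?S \<le> C1 * u ^ 3 * q / S"
    using C1 q pos \<Gamma> by (intro divide_left_mono) auto
  also have "\<dots> = C1 * u ^ 3 * 1 * ?D" using D by simp
  also have "\<dots> \<le> C1 * u ^ 3 * s * ?D" using C1 pos D s by (intro mult_left_mono mult_right_mono) auto
  also have "\<dots> = C1 * s ^ 7 * ?D" unfolding s by (simp add: power_numeral_reduce)
  finally have C1q: "C1 * u ^ 3 * q / ?S \<le> C1 * s ^ 7 * ?D" .

  have "v ^ 4 / ?S \<le> (u ^ 4 - 4 * \<alpha> * u ^ 3 * (p / sqrt ?S) + C1 * u ^ 3 * q) / ?S"
    using quartic pos unfolding q_def by (intro divide_right_mono) auto
  also have "\<dots> = u ^ 4 / ?S - 4 * \<alpha> * u ^ 3 * (p / sqrt ?S) / ?S + C1 * u ^ 3 * q / ?S"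
    by (simp add: add_divide_distrib diff_divide_distrib)
  also have "\<dots> \<le> u ^ 4 / ?S - Y * p + Y * (\<eta> * \<Gamma> / \<rho>) + Y * (\<rho> * q) + C1 * s ^ 7 * ?D"
    using err C1q split_p by (simp add: distrib_left)
  also have "Y * (\<rho> * q) \<le> 4 * \<alpha> * (4 * \<sigma>0 * sqrt B + \<sigma>1 / sqrt S0) * s ^ 7 * ?D" by (rule Y\<rho>)
  also have "u ^ 4 / ?S = u ^ 4 / S - u ^ 4 * ?D" by (simp add: algebra_simps)
  also have "Y * (\<eta> * \<Gamma> / \<rho>) = Y * \<eta> / \<rho> * (\<Gamma> - \<rho>) + Y * \<eta>"
    using \<rho> by (simp add: field_simps)
  finally show ?thesis by (simp add: algebra_simps)
qed

text \<open>
Both regimes of \<open>\<eta>\<close> have the same form: the term with \<open>u powr (7/2)\<close> is absorbed by half of the leading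
loss. The bounds on \<open>Y\<^sub>1\<close> and \<open>Y\<^sub>2\<close> serve integrability.
\<close>

lemma weighted_quartic_drift:
  fixes \<alpha> A B \<sigma>0 \<sigma>1 S0 :: real
  assumes \<alpha>: "\<alpha> > 0" and A: "A \<ge> 0" and B: "B \<ge> 0" and \<sigma>: "\<sigma>0 \<ge> 0" "\<sigma>1 > 0" and S0: "S0 > 0"
  obtains C :: real and Y1 Y2 :: "real \<Rightarrow> real \<Rightarrow> real \<Rightarrow> real"
  where "C \<ge> 0"
    and "(\<lambda>(S, u, \<eta>). Y1 S u \<eta>) \<in> borel_measurable borel"
    and "(\<lambda>(S, u, \<eta>). Y2 S u \<eta>) \<in> borel_measurable borel"
    and "\<And>S u \<eta>. S \<ge> S0 \<Longrightarrow> u \<ge> 1 \<Longrightarrow> \<eta> \<ge> 0 \<Longrightarrow> \<bar>Y1 S u \<eta>\<bar> \<le> C * u ^ 4"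
    and "\<And>S u \<eta>. S \<ge> S0 \<Longrightarrow> u \<ge> 1 \<Longrightarrow> \<eta> \<ge> 0 \<Longrightarrow> 0 \<le> Y2 S u \<eta> \<and> Y2 S u \<eta> \<le> C * u ^ 4"
    and "\<And>S u \<eta> \<Gamma> p v. \<lbrakk>S \<ge> S0; u \<ge> 1; \<eta> \<ge> 0; \<eta> \<le> B * u; \<Gamma> \<ge> 0; p\<^sup>2 \<le> \<eta> * \<Gamma>;
      \<bar>v - u + \<alpha> * (p / sqrt (S + \<Gamma>))\<bar> \<le> A * (\<Gamma> / (S + \<Gamma>))\<rbrakk> \<Longrightarrow>
      v ^ 4 / (S + \<Gamma>) \<le> u ^ 4 / S - u ^ 4 * (1 / S - 1 / (S + \<Gamma>)) / 2 + C * (1 / S - 1 / (S + \<Gamma>))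
        + Y1 S u \<eta> * (\<eta> - p) + Y2 S u \<eta> * (\<Gamma> - (\<sigma>0 * \<eta> + \<sigma>1))"
proof -
  (* In the regime eta > 16 S the quotient of sigma0 * eta + sigma1 by eta is at most m. *)
  define m where "m = \<sigma>0 + \<sigma>1 / (16 * S0)"
  define C1 where "C1 = 4 * A + 16 * (\<alpha>\<^sup>2 * B + A\<^sup>2) + 12 * (\<alpha>\<^sup>2 * B + A\<^sup>2)\<^sup>2"
  define C2 where "C2 = 4 * \<alpha> * sqrt B + C1"
  define a1 where "a1 = 4 * \<alpha> * (4 * \<sigma>0 * sqrt B + \<sigma>1 / sqrt S0) + C1"
  define a2 where "a2 = 4 * m * C2"
  define Y1 :: "real \<Rightarrow> real \<Rightarrow> real \<Rightarrow> real" where "Y1 = (\<lambda>S u \<eta>. if \<eta> \<le> 16 * S then 4 * \<alpha> * u ^ 3 / (S * sqrt S)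
      else 2 * C2 * sqrt u ^ 7 / (S * \<eta>))"
  define Y2 :: "real \<Rightarrow> real \<Rightarrow> real \<Rightarrow> real" where "Y2 = (\<lambda>S u \<eta>. if \<eta> \<le> 16 * S then 4 * \<alpha> * u ^ 3 / (S * sqrt S) * \<eta> / (\<sigma>0 * \<eta> + \<sigma>1)
      else C2 * sqrt u ^ 7 / (2 * m * \<eta> * S))"
  define b1 where "b1 = 4 * \<alpha> / (S0 * sqrt S0)"
  define b2 where "b2 = 2 * C2 / (S0 * (16 * S0))"
  define b3 where "b3 = 64 * \<alpha> / (\<sigma>1 * sqrt S0)"
  define b4 where "b4 = C2 / (2 * m * (16 * S0) * S0)"
  define C where "C = a1 * (2 * a1) ^ 7 + a2 * (2 * a2) ^ 7 + b1 + b2 + b3 + b4"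
  have m: "m > 0" unfolding m_def using \<sigma> S0 by (simp add: add_nonneg_pos)
  have C1: "C1 \<ge> 0" unfolding C1_def using A B by (intro add_nonneg_nonneg mult_nonneg_nonneg) auto
  have C2: "C2 \<ge> 0" unfolding C2_def using C1 \<alpha> B by simp
  have a1: "a1 \<ge> 0" unfolding a1_def using \<alpha> \<sigma> B C1 S0 by simp
  have a2: "a2 \<ge> 0" unfolding a2_def using m C2 by simp
  have b: "b1 \<ge> 0" "b2 \<ge> 0" "b3 \<ge> 0" "b4 \<ge> 0"
    unfolding b1_def b2_def b3_def b4_def using \<alpha> S0 C2 \<sigma> m by auto
  have c: "a1 * (2 * a1) ^ 7 \<ge> 0" "a2 * (2 * a2) ^ 7 \<ge> 0" using a1 a2 by auto
  have C_ge: "C \<ge> 0" "a1 * (2 * a1) ^ 7 \<le> C" "a2 * (2 * a2) ^ 7 \<le> C"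
    "b1 \<le> C" "b2 \<le> C" "b3 \<le> C" "b4 \<le> C"
    unfolding C_def using b c by linarith+
  show thesis
  proof (rule that[of C Y1 Y2])
    show "(\<lambda>(S, u, \<eta>). Y1 S u \<eta>) \<in> borel_measurable borel"
      unfolding Y1_def borel_prod[symmetric] by measurable
    show "(\<lambda>(S, u, \<eta>). Y2 S u \<eta>) \<in> borel_measurable borel"
      unfolding Y2_def borel_prod[symmetric] by measurable
  next
    fix S u \<eta> :: real assume S: "S \<ge> S0" and u: "u \<ge> 1" and \<eta>: "\<eta> \<ge> 0"
    have S': "S > 0" "sqrt S0 \<le> sqrt S" "sqrt S0 > 0" using S S0 by auto
    have u3: "u ^ 3 \<le> u ^ 4" using u by (intro power_increasing) auto
    have "sqrt u ^ 7 \<le> sqrt u ^ 8" using u by (intro power_increasing) auto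
    also have "sqrt u ^ 8 = (sqrt u ^ 2) ^ 4" by (simp flip: power_mult)
    also have "\<dots> = u ^ 4" using u by simp
    finally have u7: "sqrt u ^ 7 \<le> u ^ 4" .
    have to_C: "b * x \<le> C * u ^ 4" if "b \<le> C" "b \<ge> 0" "x \<le> u ^ 4" "x \<ge> 0" for b x
      using that C_ge by (intro mult_mono) auto
    have SS: "S0 * sqrt S0 \<le> S * sqrt S" using S S0 S' by (intro mult_mono) auto
    show "\<bar>Y1 S u \<eta>\<bar> \<le> C * u ^ 4"
    proof (cases "\<eta> \<le> 16 * S")
      case True
      have "4 * \<alpha> * u ^ 3 / (S * sqrt S) \<le> 4 * \<alpha> * u ^ 3 / (S0 * sqrt S0)"
        using SS S0 \<alpha> u S' by (intro divide_left_mono) auto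
      also have "\<dots> = b1 * u ^ 3" by (simp add: b1_def)
      also have "\<dots> \<le> C * u ^ 4" using C_ge b u u3 by (intro to_C) auto
      finally show ?thesis using True \<alpha> u S' by (simp add: Y1_def)
    next
      case False
      have "2 * C2 * sqrt u ^ 7 / (S * \<eta>) \<le> 2 * C2 * sqrt u ^ 7 / (S0 * (16 * S0))"
        using False S S0 C2 u by (intro divide_left_mono mult_mono) auto
      also have "\<dots> = b2 * sqrt u ^ 7" by (simp add: b2_def)
      also have "\<dots> \<le> C * u ^ 4" using C_ge b u u7 by (intro to_C) auto
      finally show ?thesis using False \<eta> C2 u S' by (simp add: Y1_def)
    qed
    show "0 \<le> Y2 S u \<eta> \<and> Y2 S u \<eta> \<le> C * u ^ 4"
    proof (cases "\<eta> \<le> 16 * S")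
      case True
      have "\<eta> / (\<sigma>0 * \<eta> + \<sigma>1) \<le> 16 * S / \<sigma>1"
        using True \<eta> \<sigma> S' by (intro frac_le) auto
      then have "4 * \<alpha> * u ^ 3 / (S * sqrt S) * (\<eta> / (\<sigma>0 * \<eta> + \<sigma>1)) \<le> 4 * \<alpha> * u ^ 3 / (S * sqrt S) * (16 * S / \<sigma>1)"
        using \<alpha> u S' by (intro mult_left_mono) auto
      also have "\<dots> = 64 * \<alpha> * u ^ 3 / (\<sigma>1 * sqrt S)" using S' by (simp add: field_simps)
      also have "\<dots> \<le> 64 * \<alpha> * u ^ 3 / (\<sigma>1 * sqrt S0)"
        using S' \<alpha> u \<sigma> by (intro divide_left_mono mult_left_mono) auto
      also have "\<dots> = b3 * u ^ 3" by (simp add: b3_def)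
      also have "\<dots> \<le> C * u ^ 4" using C_ge b u u3 by (intro to_C) auto
      finally show ?thesis using True \<alpha> u S' \<eta> \<sigma> by (simp add: Y2_def)
    next
      case False
      have "C2 * sqrt u ^ 7 / (2 * m * \<eta> * S) \<le> C2 * sqrt u ^ 7 / (2 * m * (16 * S0) * S0)"
        using False S S0 C2 u m by (intro divide_left_mono mult_mono) auto
      also have "\<dots> = b4 * sqrt u ^ 7" by (simp add: b4_def)
      also have "\<dots> \<le> C * u ^ 4" using C_ge b u u7 by (intro to_C) auto
      finally show ?thesis using False \<eta> C2 u S' m by (simp add: Y2_def)
    qed
  next
    fix S u \<eta> \<Gamma> p v :: real
    assume S: "S \<ge> S0" and u: "u \<ge> 1" and \<eta>: "\<eta> \<ge> 0" "\<eta> \<le> B * u" and \<Gamma>: "\<Gamma> \<ge> 0" and p: "p\<^sup>2 \<le> \<eta> * \<Gamma>"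
      and step: "\<bar>v - u + \<alpha> * (p / sqrt (S + \<Gamma>))\<bar> \<le> A * (\<Gamma> / (S + \<Gamma>))"
    let ?S = "S + \<Gamma>" and ?D = "1 / S - 1 / (S + \<Gamma>)" and ?\<rho> = "\<sigma>0 * \<eta> + \<sigma>1"
    have pos: "S > 0" "?S > 0" using S S0 \<Gamma> by auto
    have s: "sqrt u \<ge> 1" "u = (sqrt u)\<^sup>2" using u by auto
    have u4: "sqrt u ^ 8 = u ^ 4" by (subst (2) s(2)) (simp flip: power_mult)
    have D: "?D \<ge> 0" using pos \<Gamma> by (simp add: field_simps)
    have q: "0 \<le> \<Gamma> / ?S" "\<Gamma> / ?S \<le> 1" using pos \<Gamma> S0 S by (auto simp: divide_le_eq)
    have "(p / sqrt ?S)\<^sup>2 = p\<^sup>2 / ?S" using pos by (simp add: power_divide)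
    also have "\<dots> \<le> \<eta> * (\<Gamma> / ?S)" using p pos by (simp add: divide_right_mono)
    also have "\<dots> \<le> B * u * (\<Gamma> / ?S)" using \<eta> q by (intro mult_right_mono)
    finally have quartic: "v ^ 4 \<le> u ^ 4 - 4 * \<alpha> * u ^ 3 * (p / sqrt ?S) + C1 * u ^ 3 * (\<Gamma> / ?S)"
      unfolding C1_def using quartic_increment[OF u q step] by simp
    have absorb: "a * sqrt u ^ 7 * ?D \<le> u ^ 4 * ?D / 2 + C * ?D" if "a \<ge> 0" "a * (2 * a) ^ 7 \<le> C" for a
    proof -
      have "a * sqrt u ^ 7 \<le> u ^ 4 / 2 + C"
        using lower_power_absorb[of "sqrt u" a] that s by (simp add: u4)
      then have "a * sqrt u ^ 7 * ?D \<le> (u ^ 4 / 2 + C) * ?D" using D by (intro mult_right_mono)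
      also have "\<dots> = u ^ 4 * ?D / 2 + C * ?D" by (simp only: distrib_right) simp
      finally show ?thesis .
    qed
    have combine: "x \<le> y - d / 2 + c + r1 + r2"
      if "x \<le> y - d + a + r1 + r2" "a \<le> d / 2 + c" for x y d a c r1 r2 :: real
      using that by linarith
    show "v ^ 4 / ?S \<le> u ^ 4 / S - u ^ 4 * ?D / 2 + C * ?D + Y1 S u \<eta> * (\<eta> - p) + Y2 S u \<eta> * (\<Gamma> - ?\<rho>)"
    proof (cases "\<eta> \<le> 16 * S")
      case True
      have "v ^ 4 / ?S \<le> u ^ 4 / S - u ^ 4 * ?D + a1 * sqrt u ^ 7 * ?D + Y1 S u \<eta> * (\<eta> - p) + Y2 S u \<eta> * (\<Gamma> - ?\<rho>)"
        using flat_drift[OF S S0 True \<eta>(1) \<Gamma> p \<sigma> s \<eta>(2) less_imp_le[OF \<alpha>] B C1 quartic] True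
        unfolding a1_def Y1_def Y2_def by simp
      then show ?thesis using absorb[OF a1 C_ge(2)] by (rule combine)
    next
      case False
      have "\<sigma>1 \<le> \<sigma>1 / (16 * S0) * \<eta>" using False S S0 \<sigma> by (simp add: field_simps)
      then have "?\<rho> \<le> m * \<eta>" unfolding m_def by (simp add: distrib_right)
      then have "v ^ 4 / ?S \<le> u ^ 4 / S - u ^ 4 * ?D + a2 * sqrt u ^ 7 * ?D + Y1 S u \<eta> * (\<eta> - p) + Y2 S u \<eta> * (\<Gamma> - ?\<rho>)"
        using steep_drift[OF pos(1) _ \<Gamma> p _ m s \<eta>(2) less_imp_le[OF \<alpha>] B C1 quartic, of ?\<rho>] False
        unfolding a2_def C2_def Y1_def Y2_def by simp
      then show ?thesis using absorb[OF a2 C_ge(3)] by (rule combine)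
    qed
  qed (use C_ge in auto)
qed

text \<open>
In \<open>sqrt S' * v\<close> the step size cancels and \<open>p\<close> appears with a constant coefficient. What remains,
\<open>a u (sqrt S' - sqrt S)\<close>, is split at \<open>a u = \<delta> sqrt S'\<close>: below it is at most \<open>\<delta> \<Gamma>\<close>, and above it is
at most \<open>k u\<^sup>4 (1/S - 1/S')\<close>, which \<open>2 k u\<^sup>4 / S\<close> pays for. The summand \<open>K\<close> makes the constant multiple
of \<open>1/S - 1/S'\<close> telescope.
\<close>

lemma adagrad_lyapunov_drift:
  fixes \<alpha> A B \<sigma>0 \<sigma>1 S0 :: real
  assumes \<alpha>: "\<alpha> > 0" and A: "A \<ge> 0" and B: "B \<ge> 0" and \<sigma>: "\<sigma>0 \<ge> 0" "\<sigma>1 > 0" and S0: "S0 > 0"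
  obtains c K R :: real and Z1 Z2 :: "real \<Rightarrow> real \<Rightarrow> real \<Rightarrow> real"
  where "c \<ge> 0" "K \<ge> 0" "R \<ge> 0"
    and "(\<lambda>(S, u, \<eta>). Z1 S u \<eta>) \<in> borel_measurable borel"
    and "(\<lambda>(S, u, \<eta>). Z2 S u \<eta>) \<in> borel_measurable borel"
    and "\<And>S u \<eta>. S \<ge> S0 \<Longrightarrow> u \<ge> 1 \<Longrightarrow> \<eta> \<ge> 0 \<Longrightarrow> \<bar>Z1 S u \<eta>\<bar> \<le> R * u ^ 4"
    and "\<And>S u \<eta>. S \<ge> S0 \<Longrightarrow> u \<ge> 1 \<Longrightarrow> \<eta> \<ge> 0 \<Longrightarrow> 0 \<le> Z2 S u \<eta> \<and> Z2 S u \<eta> \<le> R * u ^ 4"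
    and "\<And>S u \<eta> \<Gamma> p v. \<lbrakk>S \<ge> S0; u \<ge> 1; \<eta> \<ge> 0; \<eta> \<le> B * u; \<Gamma> \<ge> 0; p\<^sup>2 \<le> \<eta> * \<Gamma>;
      \<bar>v - u + \<alpha> * (p / sqrt (S + \<Gamma>))\<bar> \<le> A * (\<Gamma> / (S + \<Gamma>))\<rbrakk> \<Longrightarrow>
      sqrt (S + \<Gamma>) * v + c * (v ^ 4 + K) / (S + \<Gamma>) \<le> sqrt S * u + c * (u ^ 4 + K) / S
        - \<alpha> / 2 * \<eta> + R + Z1 S u \<eta> * (\<eta> - p) + Z2 S u \<eta> * (\<Gamma> - (\<sigma>0 * \<eta> + \<sigma>1))"
proof -
  obtain C Y1 Y2 where C: "C \<ge> 0"
    and Y1_meas: "(\<lambda>(S, u, \<eta>). Y1 S u \<eta>) \<in> borel_measurable borel"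
    and Y2_meas: "(\<lambda>(S, u, \<eta>). Y2 S u \<eta>) \<in> borel_measurable borel"
    and Y1_bound: "\<And>S u \<eta>. S \<ge> S0 \<Longrightarrow> u \<ge> 1 \<Longrightarrow> \<eta> \<ge> 0 \<Longrightarrow> \<bar>Y1 S u \<eta>\<bar> \<le> C * u ^ 4"
    and Y2_bound: "\<And>S u \<eta>. S \<ge> S0 \<Longrightarrow> u \<ge> 1 \<Longrightarrow> \<eta> \<ge> 0 \<Longrightarrow> 0 \<le> Y2 S u \<eta> \<and> Y2 S u \<eta> \<le> C * u ^ 4"
    and quartic: "\<And>S u \<eta> \<Gamma> p v. \<lbrakk>S \<ge> S0; u \<ge> 1; \<eta> \<ge> 0; \<eta> \<le> B * u; \<Gamma> \<ge> 0; p\<^sup>2 \<le> \<eta> * \<Gamma>;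
      \<bar>v - u + \<alpha> * (p / sqrt (S + \<Gamma>))\<bar> \<le> A * (\<Gamma> / (S + \<Gamma>))\<rbrakk> \<Longrightarrow>
      v ^ 4 / (S + \<Gamma>) \<le> u ^ 4 / S - u ^ 4 * (1 / S - 1 / (S + \<Gamma>)) / 2 + C * (1 / S - 1 / (S + \<Gamma>))
        + Y1 S u \<eta> * (\<eta> - p) + Y2 S u \<eta> * (\<Gamma> - (\<sigma>0 * \<eta> + \<sigma>1))"
  proof (rule weighted_quartic_drift[OF assms], goal_cases)
    case (1 C Y1 Y2)
    show ?case by (rule 1(1)[OF 1(2-)])
  qed
  (* A delta that leaves half of alpha * eta after the mean of delta * Gamma has been subtracted. *)
  define \<delta> where "\<delta> = \<alpha> / (2 * (\<sigma>0 + 1))"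
  define a where "a = 1 + 2 * A"
  define k where "k = a * (a / \<delta>) ^ 3"
  define R where "R = \<alpha> + \<delta> * (1 + \<sigma>1) + 2 * k * C"
  define Z1 where "Z1 = (\<lambda>S u \<eta>. \<alpha> + 2 * k * Y1 S u \<eta>)"
  define Z2 where "Z2 = (\<lambda>S u \<eta>. \<delta> + 2 * k * Y2 S u \<eta>)"
  have \<delta>: "\<delta> > 0" "\<delta> * \<sigma>0 \<le> \<alpha> / 2"
    unfolding \<delta>_def using \<alpha> \<sigma> by (auto simp: field_simps)
  have a: "a \<ge> 1" unfolding a_def using A by simp
  have k: "k \<ge> 0" unfolding k_def using a \<delta> by simp
  have R: "R \<ge> 0" "\<delta> * \<sigma>1 \<le> R" "\<alpha> + 2 * k * C \<le> R" "\<delta> + 2 * k * C \<le> R"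
    unfolding R_def using \<alpha> \<delta> \<sigma> k C by (auto simp: distrib_left)
  have absorb_const: "x + 2 * k * y \<le> R * u ^ 4"
    if "u \<ge> 1" "x \<ge> 0" "x + 2 * k * C \<le> R" "y \<le> C * u ^ 4" for x y u :: real
  proof -
    have "u ^ 4 \<ge> 1" using that by simp
    then have "x * 1 \<le> x * u ^ 4" using that by (intro mult_left_mono)
    moreover have "2 * k * y \<le> 2 * k * (C * u ^ 4)" using that k by (intro mult_left_mono) auto
    moreover have "(x + 2 * k * C) * u ^ 4 \<le> R * u ^ 4" using that by (intro mult_right_mono) auto
    ultimately show ?thesis by (simp add: algebra_simps)
  qed
  show thesis
  proof (rule that[of "2 * k" C R Z1 Z2])
    show "(\<lambda>(S, u, \<eta>). Z1 S u \<eta>) \<in> borel_measurable borel"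
    proof -
      have "(\<lambda>x. \<alpha> + 2 * k * (case x of (S, u, \<eta>) \<Rightarrow> Y1 S u \<eta>)) \<in> borel_measurable borel"
        using Y1_meas by measurable
      then show ?thesis by (simp add: Z1_def split_beta')
    qed
    show "(\<lambda>(S, u, \<eta>). Z2 S u \<eta>) \<in> borel_measurable borel"
    proof -
      have "(\<lambda>x. \<delta> + 2 * k * (case x of (S, u, \<eta>) \<Rightarrow> Y2 S u \<eta>)) \<in> borel_measurable borel"
        using Y2_meas by measurable
      then show ?thesis by (simp add: Z2_def split_beta')
    qed
    fix S u \<eta> :: real assume su: "S \<ge> S0" "u \<ge> 1" "\<eta> \<ge> 0"
    have "\<bar>Z1 S u \<eta>\<bar> \<le> \<alpha> + 2 * k * \<bar>Y1 S u \<eta>\<bar>"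
      unfolding Z1_def using \<alpha> k abs_triangle_ineq[of \<alpha> "2 * k * Y1 S u \<eta>"] by (simp add: abs_mult)
    also have "\<dots> \<le> R * u ^ 4" using Y1_bound[OF su] su \<alpha> R by (intro absorb_const) auto
    finally show "\<bar>Z1 S u \<eta>\<bar> \<le> R * u ^ 4" .
    show "0 \<le> Z2 S u \<eta> \<and> Z2 S u \<eta> \<le> R * u ^ 4"
      using Y2_bound[OF su] su \<delta> R k unfolding Z2_def by (auto intro!: absorb_const)
  next
    fix S u \<eta> \<Gamma> p v :: real
    assume S: "S \<ge> S0" and u: "u \<ge> 1" and \<eta>: "\<eta> \<ge> 0" "\<eta> \<le> B * u" and \<Gamma>: "\<Gamma> \<ge> 0" and p: "p\<^sup>2 \<le> \<eta> * \<Gamma>"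
      and step: "\<bar>v - u + \<alpha> * (p / sqrt (S + \<Gamma>))\<bar> \<le> A * (\<Gamma> / (S + \<Gamma>))"
    let ?S = "S + \<Gamma>" and ?D = "1 / S - 1 / (S + \<Gamma>)" and ?\<rho> = "\<sigma>0 * \<eta> + \<sigma>1"
    define e where "e = sqrt ?S - sqrt S"
    have pos: "S > 0" "?S > 0" using S S0 \<Gamma> by auto
    have D: "?D = \<Gamma> / (S * ?S)" using pos by (simp add: field_simps)
    have sq: "sqrt ?S * sqrt ?S = ?S" "sqrt S * sqrt S = S" using pos by auto
    have e0: "e \<ge> 0" unfolding e_def using \<Gamma> by simp
    have "\<Gamma> = e * (sqrt ?S + sqrt S)" unfolding e_def using sq by (simp add: algebra_simps)
    moreover have "e * (sqrt ?S + sqrt S) \<le> e * (2 * sqrt ?S)" "e * (sqrt ?S) \<le> e * (sqrt ?S + sqrt S)"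
      using e0 \<Gamma> pos by (auto intro!: mult_left_mono)
    ultimately have e: "\<Gamma> / sqrt ?S \<le> 2 * e" "e \<le> \<Gamma> / sqrt ?S" using pos by (auto simp: field_simps)

    have "t * (\<Gamma> / (t * t)) = \<Gamma> / t" if "t > 0" for t :: real using that by simp
    from this[of "sqrt ?S"] have sqrt_cancel: "sqrt ?S * (\<Gamma> / ?S) = \<Gamma> / sqrt ?S"
      unfolding sq using pos by simp
    have "v \<le> u - \<alpha> * (p / sqrt ?S) + A * (\<Gamma> / ?S)" using step by linarith
    then have "sqrt ?S * v \<le> sqrt ?S * (u - \<alpha> * (p / sqrt ?S) + A * (\<Gamma> / ?S))"
      using pos by (intro mult_left_mono) auto
    also have "\<dots> = sqrt ?S * u - \<alpha> * p + A * (\<Gamma> / sqrt ?S)"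
      unfolding sqrt_cancel[symmetric] using pos by (simp add: right_diff_distrib distrib_left mult_ac)
    also have "A * (\<Gamma> / sqrt ?S) \<le> A * (2 * e)" using A e by (intro mult_left_mono)
    also have "A * (2 * e) = A * (2 * e) * 1" by simp
    also have "A * (2 * e) * 1 \<le> A * (2 * e) * u" using A e0 u by (intro mult_left_mono) auto
    finally have lin: "sqrt ?S * v \<le> sqrt S * u - \<alpha> * p + a * u * e"
      unfolding a_def e_def by (simp add: algebra_simps)

    have "a * u * e \<le> a * u * (\<Gamma> / sqrt ?S)" using a u e by (intro mult_left_mono) auto
    also have "\<dots> \<le> \<delta> * \<Gamma> + k * (u ^ 4 * ?D)"
    proof (cases "a * u \<le> \<delta> * sqrt ?S")
      case True
      then have "a * u * (\<Gamma> / sqrt ?S) \<le> \<delta> * sqrt ?S * (\<Gamma> / sqrt ?S)"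
        using \<Gamma> pos by (intro mult_right_mono) auto
      also have "\<dots> = \<delta> * \<Gamma>" using pos by simp
      finally show ?thesis using k D \<Gamma> pos by (simp add: add_increasing2)
    next
      case False
      have "S * sqrt ?S \<le> ?S * sqrt ?S" using \<Gamma> pos by (intro mult_right_mono) auto
      also have "\<dots> = sqrt ?S ^ 3" using sq by (simp add: power3_eq_cube)
      also have "\<dots> \<le> (a / \<delta> * u) ^ 3" using False \<delta> pos by (intro power_mono) (auto simp: field_simps)
      finally have "S * sqrt ?S \<le> (a / \<delta>) ^ 3 * u ^ 3" by (simp add: power_mult_distrib power_divide)
      then have "a * u * (\<Gamma> / (S * ?S)) * (S * sqrt ?S) \<le> a * u * (\<Gamma> / (S * ?S)) * ((a / \<delta>) ^ 3 * u ^ 3)"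
        using a u \<Gamma> pos by (intro mult_left_mono) auto
      moreover have "a * u * (\<Gamma> / (S * ?S)) * (S * sqrt ?S) = a * u * (\<Gamma> / sqrt ?S)"
        unfolding sqrt_cancel[symmetric] using pos by simp
      moreover have "a * u * (\<Gamma> / (S * ?S)) * ((a / \<delta>) ^ 3 * u ^ 3) = k * (u ^ 4 * ?D)"
        unfolding k_def D by (simp add: power_numeral_reduce mult_ac)
      moreover have "\<delta> * \<Gamma> \<ge> 0" using \<delta> \<Gamma> by simp
      ultimately show ?thesis by linarith
    qed
    finally have main: "sqrt ?S * v \<le> sqrt S * u - \<alpha> * p + \<delta> * \<Gamma> + k * (u ^ 4 * ?D)" using lin by linarith

    have expand: "2 * k * (y - d / 2 + C * (x - x') + z1 * f1 + z2 * f2)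
        = 2 * k * y - k * d + 2 * k * (C * x) - 2 * k * (C * x') + 2 * k * z1 * f1 + 2 * k * z2 * f2"
      for y d x x' z1 f1 z2 f2 :: real by (simp add: algebra_simps)
    have "2 * k * (v ^ 4 / ?S) \<le> 2 * k * (u ^ 4 / S - u ^ 4 * ?D / 2 + C * ?D
        + Y1 S u \<eta> * (\<eta> - p) + Y2 S u \<eta> * (\<Gamma> - ?\<rho>))"
      using k quartic[OF S u \<eta> \<Gamma> p step] by (intro mult_left_mono) auto
    also have "\<dots> = 2 * k * (u ^ 4 / S) - k * (u ^ 4 * ?D) + 2 * k * (C / S) - 2 * k * (C / ?S)
        + 2 * k * Y1 S u \<eta> * (\<eta> - p) + 2 * k * Y2 S u \<eta> * (\<Gamma> - ?\<rho>)"
      unfolding expand by simp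
    finally have quart: "2 * k * (v ^ 4 / ?S) + 2 * k * (C / ?S) \<le> 2 * k * (u ^ 4 / S) + 2 * k * (C / S)
        - k * (u ^ 4 * ?D) + 2 * k * Y1 S u \<eta> * (\<eta> - p) + 2 * k * Y2 S u \<eta> * (\<Gamma> - ?\<rho>)" by simp
    have "\<delta> * \<sigma>0 * \<eta> \<le> \<alpha> / 2 * \<eta>" using \<delta> \<eta> by (intro mult_right_mono)
    then have mean_part: "- (\<alpha> * p) + \<delta> * \<Gamma> \<le> - (\<alpha> / 2 * \<eta>) + R + \<alpha> * (\<eta> - p) + \<delta> * (\<Gamma> - ?\<rho>)"
      using R(2) by (simp add: algebra_simps)
    have combine: "x' + y' \<le> x + y - h + r + (z1 + w1) + (z2 + w2)"
      if "x' \<le> x - e + f + d" "y' \<le> y - d + w1 + w2" "- e + f \<le> - h + r + z1 + z2"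
      for x x' y y' d e f h r z1 z2 w1 w2 :: real
      using that by linarith
    have quart_sum: "2 * k * (x + C) / y = 2 * k * (x / y) + 2 * k * (C / y)" for x y :: real
      by (simp add: distrib_left add_divide_distrib)
    have Z_split: "Z1 S u \<eta> * (\<eta> - p) = \<alpha> * (\<eta> - p) + 2 * k * Y1 S u \<eta> * (\<eta> - p)"
      "Z2 S u \<eta> * (\<Gamma> - ?\<rho>) = \<delta> * (\<Gamma> - ?\<rho>) + 2 * k * Y2 S u \<eta> * (\<Gamma> - ?\<rho>)"
      by (simp_all add: Z1_def Z2_def distrib_right)
    show "sqrt ?S * v + 2 * k * (v ^ 4 + C) / ?S \<le> sqrt S * u + 2 * k * (u ^ 4 + C) / S
        - \<alpha> / 2 * \<eta> + R + Z1 S u \<eta> * (\<eta> - p) + Z2 S u \<eta> * (\<Gamma> - ?\<rho>)"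
      unfolding quart_sum Z_split by (rule combine[OF main _ mean_part]) (use quart in simp)
  qed (use k C R in auto)
qed

section \<open>Conditional means and second moments\<close>

text \<open>
Testing against \<open>Y = 1\<close> shows that \<open>X\<close> is integrable, so that the inequality between nonnegative
integrals becomes one between Bochner integrals.
\<close>

lemma (in finite_measure_subalgebra) integral_cond_bound:
  fixes X Y \<rho> :: "'a \<Rightarrow> real"
  assumes X[measurable]: "X \<in> borel_measurable M" and X_nonneg: "\<And>x. X x \<ge> 0"
    and \<rho>[measurable]: "\<rho> \<in> borel_measurable F"
    and \<rho>_bound: "\<And>x. x \<in> space M \<Longrightarrow> 0 \<le> \<rho> x \<and> \<rho> x \<le> r"
    and bound: "AE x in M. nn_cond_exp M F (\<lambda>x. ennreal (X x)) x \<le> ennreal (\<rho> x)"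
    and Y[measurable]: "Y \<in> borel_measurable F"
    and Y_bound: "\<And>x. x \<in> space M \<Longrightarrow> 0 \<le> Y x \<and> Y x \<le> b"
  shows "integrable M X" and "integrable M (\<lambda>x. Y x * X x)"
    and "integrable M (\<lambda>x. Y x * \<rho> x)"
    and "(\<integral>x. Y x * X x \<partial>M) \<le> (\<integral>x. Y x * \<rho> x \<partial>M)"
proof -
  have [measurable]: "\<rho> \<in> borel_measurable M" "Y \<in> borel_measurable M"
    using measurable_from_subalg[OF subalg \<rho>] measurable_from_subalg[OF subalg Y] by auto
  have test: "(\<integral>\<^sup>+x. ennreal (Z x * X x) \<partial>M) \<le> (\<integral>\<^sup>+x. ennreal (Z x * \<rho> x) \<partial>M)"
    if Z[measurable]: "Z \<in> borel_measurable F" and Z0: "\<And>x. x \<in> space M \<Longrightarrow> 0 \<le> Z x" for Z :: "'a \<Rightarrow> real"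
  proof -
    have "(\<integral>\<^sup>+x. ennreal (Z x * X x) \<partial>M) = (\<integral>\<^sup>+x. ennreal (Z x) * ennreal (X x) \<partial>M)"
      using Z0 X_nonneg by (intro nn_integral_cong) (simp add: ennreal_mult)
    also have "\<dots> = (\<integral>\<^sup>+x. ennreal (Z x) * nn_cond_exp M F (\<lambda>x. ennreal (X x)) x \<partial>M)"
      by (rule nn_cond_exp_intg[symmetric]) auto
    also have "\<dots> \<le> (\<integral>\<^sup>+x. ennreal (Z x) * ennreal (\<rho> x) \<partial>M)"
      using bound by (intro nn_integral_mono_AE) (auto elim!: eventually_mono intro: mult_left_mono)
    also have "\<dots> = (\<integral>\<^sup>+x. ennreal (Z x * \<rho> x) \<partial>M)"
      using Z0 \<rho>_bound by (intro nn_integral_cong) (simp add: ennreal_mult)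
    finally show ?thesis .
  qed
  have \<rho>_int: "integrable M \<rho>"
    using \<rho>_bound by (intro integrable_const_bound[where B = r] AE_I2) auto
  have prod_bound: "\<bar>Y x * \<rho> x\<bar> \<le> b * r" if "x \<in> space M" for x
    using \<rho>_bound[OF that] Y_bound[OF that] by (auto simp: abs_mult intro!: mult_mono)
  show Y\<rho>_int: "integrable M (\<lambda>x. Y x * \<rho> x)"
    using prod_bound by (intro integrable_const_bound[where B = "b * r"] AE_I2) auto
  show X_int: "integrable M X"
  proof (rule integrableI_nonneg)
    have "(\<integral>\<^sup>+x. ennreal (X x) \<partial>M) \<le> (\<integral>\<^sup>+x. ennreal (\<rho> x) \<partial>M)"
      using test[of "\<lambda>_. 1"] by simp
    also have "\<dots> = ennreal (\<integral>x. \<rho> x \<partial>M)"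
      using \<rho>_int \<rho>_bound by (intro nn_integral_eq_integral AE_I2) auto
    finally show "(\<integral>\<^sup>+x. ennreal (X x) \<partial>M) < \<infinity>" by (simp add: order_le_less_trans)
  qed (use X_nonneg in auto)
  show YX_int: "integrable M (\<lambda>x. Y x * X x)"
  proof (rule Bochner_Integration.integrable_bound[where f = "\<lambda>x. b * X x"])
    have "norm (Y x * X x) \<le> norm (b * X x)" if "x \<in> space M" for x
      using Y_bound[OF that] X_nonneg[of x] by (simp add: abs_mult mult_right_mono)
    then show "AE x in M. norm (Y x * X x) \<le> norm (b * X x)" by (intro AE_I2)
  qed (use X_int in auto)
  have "ennreal (\<integral>x. Y x * X x \<partial>M) = (\<integral>\<^sup>+x. ennreal (Y x * X x) \<partial>M)"
    using YX_int X_nonneg Y_bound by (intro nn_integral_eq_integral[symmetric] AE_I2) auto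
  also have "\<dots> \<le> (\<integral>\<^sup>+x. ennreal (Y x * \<rho> x) \<partial>M)"
    using test[OF Y] Y_bound by auto
  also have "\<dots> = ennreal (\<integral>x. Y x * \<rho> x \<partial>M)"
    using Y\<rho>_int \<rho>_bound Y_bound by (intro nn_integral_eq_integral AE_I2) auto
  finally show "(\<integral>x. Y x * X x \<partial>M) \<le> (\<integral>x. Y x * \<rho> x \<partial>M)"
    using \<rho>_bound Y_bound by (subst (asm) ennreal_le_iff) (auto intro!: integral_nonneg_AE AE_I2)
qed

text \<open>
Coordinate by coordinate this is the defining property of the conditional expectation with the test
function \<open>Y x * (m x \<bullet> i)\<close>; boundedness of \<open>Y\<close> and \<open>m\<close> makes the products integrable.
\<close>

lemma (in finite_measure_subalgebra) integral_cond_mean: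
  fixes X m :: "'a \<Rightarrow> 'v::euclidean_space" and Y :: "'a \<Rightarrow> real"
  assumes X[measurable]: "X \<in> borel_measurable M" and X_int: "integrable M (\<lambda>x. (norm (X x))\<^sup>2)"
    and m[measurable]: "m \<in> borel_measurable F" and m_bound: "\<And>x. x \<in> space M \<Longrightarrow> norm (m x) \<le> r"
    and mean: "AE x in M. vec_cond_exp M F X x = m x"
    and Y[measurable]: "Y \<in> borel_measurable F" and Y_bound: "\<And>x. x \<in> space M \<Longrightarrow> \<bar>Y x\<bar> \<le> b"
  shows "integrable M (\<lambda>x. Y x * (m x \<bullet> X x))"
    and "integrable M (\<lambda>x. Y x * (norm (m x))\<^sup>2)"
    and "(\<integral>x. Y x * (m x \<bullet> X x) \<partial>M) = (\<integral>x. Y x * (norm (m x))\<^sup>2 \<partial>M)"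
proof -
  have [measurable]: "m \<in> borel_measurable M" "Y \<in> borel_measurable M"
    using measurable_from_subalg[OF subalg m] measurable_from_subalg[OF subalg Y] by auto
  have X1_int: "integrable M (\<lambda>x. norm (X x))"
  proof (rule Bochner_Integration.integrable_bound[where f = "\<lambda>x. 1 + (norm (X x))\<^sup>2"])
    have "norm (norm (X x)) \<le> norm (1 + (norm (X x))\<^sup>2)" for x
      using sum_squares_bound[of 1 "norm (X x)"] norm_ge_zero[of "X x"] by (simp del: norm_ge_zero)
    then show "AE x in M. norm (norm (X x)) \<le> norm (1 + (norm (X x))\<^sup>2)" by (intro AE_I2)
  qed (use X_int in auto)
  have coord_int: "integrable M (\<lambda>x. Y x * (m x \<bullet> i) * (X x \<bullet> i))" if i: "i \<in> Basis" for i
  proof (rule Bochner_Integration.integrable_bound[where f = "\<lambda>x. b * r * norm (X x)"])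
    have "norm (Y x * (m x \<bullet> i) * (X x \<bullet> i)) \<le> norm (b * r * norm (X x))" if x: "x \<in> space M" for x
    proof -
      have "\<bar>m x \<bullet> i\<bar> \<le> r" "\<bar>X x \<bullet> i\<bar> \<le> norm (X x)"
        using Basis_le_norm[OF i, of "m x"] Basis_le_norm[OF i, of "X x"] m_bound[OF x] by auto
      moreover have "b \<ge> 0" "r \<ge> 0"
        using Y_bound[OF x] m_bound[OF x] norm_ge_zero[of "m x"] by linarith+
      ultimately show ?thesis using Y_bound[OF x] by (simp add: abs_mult) (intro mult_mono, auto)
    qed
    then show "AE x in M. norm (Y x * (m x \<bullet> i) * (X x \<bullet> i)) \<le> norm (b * r * norm (X x))" by (intro AE_I2)
  qed (use X1_int in auto)
  have mean_coord: "AE x in M. real_cond_exp M F (\<lambda>x. X x \<bullet> i) x = m x \<bullet> i" if i: "i \<in> Basis" for i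
  proof -
    have "vec_cond_exp M F X x \<bullet> i = real_cond_exp M F (\<lambda>x. X x \<bullet> i) x" for x
      using i by (simp add: vec_cond_exp_def)
    note coord = this
    from mean show ?thesis by eventually_elim (metis coord)
  qed
  have coord: "integrable M (\<lambda>x. Y x * (m x \<bullet> i) * (m x \<bullet> i))"
    "(\<integral>x. Y x * (m x \<bullet> i) * (X x \<bullet> i) \<partial>M) = (\<integral>x. Y x * (m x \<bullet> i) * (m x \<bullet> i) \<partial>M)" if i: "i \<in> Basis" for i
  proof -
    have test: "(\<lambda>x. Y x * (m x \<bullet> i)) \<in> borel_measurable F" by measurable
    have meas: "(\<lambda>x. X x \<bullet> i) \<in> borel_measurable M" by measurable
    have ae: "AE x in M. Y x * (m x \<bullet> i) * real_cond_exp M F (\<lambda>x. X x \<bullet> i) x = Y x * (m x \<bullet> i) * (m x \<bullet> i)"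
      using mean_coord[OF i] by (auto elim!: eventually_mono)
    note ce = real_cond_exp_intg[OF coord_int[OF i] test meas]
    show "integrable M (\<lambda>x. Y x * (m x \<bullet> i) * (m x \<bullet> i))"
      using ce(1) ae by (subst integrable_cong_AE[symmetric]) auto
    show "(\<integral>x. Y x * (m x \<bullet> i) * (X x \<bullet> i) \<partial>M) = (\<integral>x. Y x * (m x \<bullet> i) * (m x \<bullet> i) \<partial>M)"
      unfolding ce(2)[symmetric] using ae by (intro integral_cong_AE) auto
  qed
  have expand: "Y x * (m x \<bullet> X x) = (\<Sum>i\<in>Basis. Y x * (m x \<bullet> i) * (X x \<bullet> i))"
    "Y x * (norm (m x))\<^sup>2 = (\<Sum>i\<in>Basis. Y x * (m x \<bullet> i) * (m x \<bullet> i))" for x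
    unfolding power2_norm_eq_inner
    by (subst euclidean_inner, simp add: sum_distrib_left mult.assoc)+
  show "integrable M (\<lambda>x. Y x * (m x \<bullet> X x))" "integrable M (\<lambda>x. Y x * (norm (m x))\<^sup>2)"
    unfolding expand using coord_int coord(1) by auto
  show "(\<integral>x. Y x * (m x \<bullet> X x) \<partial>M) = (\<integral>x. Y x * (norm (m x))\<^sup>2 \<partial>M)"
    unfolding expand using coord_int coord by (simp add: Bochner_Integration.integral_sum)
qed

section \<open>AdaGrad-Norm and the noise filtration\<close>

lemma space_noise_filtration [simp]: "space (noise_filtration M N X \<xi> n) = space M"
  unfolding noise_filtration_def by (subst space_measure_of) auto

lemma sets_noise_filtration:
  "sets (noise_filtration M N X \<xi> n) = sigma_sets (space M)
     (if n = 0 then {}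
      else {X -` A \<inter> space M |A. A \<in> sets borel} \<union>
           {\<xi> i -` B \<inter> space M |i B. i \<in> {1..n} \<and> B \<in> sets N})"
  unfolding noise_filtration_def by (subst sets_measure_of) auto

lemma subalgebra_noise_filtration:
  assumes X: "X \<in> borel_measurable M" and \<xi>: "\<And>i. i \<ge> 1 \<Longrightarrow> \<xi> i \<in> measurable M N"
  shows "subalgebra M (noise_filtration M N X \<xi> n)"
proof -
  have "sets (noise_filtration M N X \<xi> n) \<subseteq> sets M"
    unfolding sets_noise_filtration
    by (intro sets.sigma_sets_subset) (use X \<xi> in \<open>auto intro: measurable_sets\<close>)
  then show ?thesis by (simp add: subalgebra_def)
qed

lemma subalgebra_noise_filtration_Suc:
  "subalgebra (noise_filtration M N X \<xi> (Suc n)) (noise_filtration M N X \<xi> n)"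
proof -
  have "sets (noise_filtration M N X \<xi> n) \<subseteq> sets (noise_filtration M N X \<xi> (Suc n))"
    unfolding sets_noise_filtration by (rule sigma_sets_mono') (simp, blast intro: le_SucI)
  then show ?thesis by (simp add: subalgebra_def)
qed

lemma measurable_noise_filtration:
  assumes \<xi>: "\<xi> i \<in> measurable M N" and i: "1 \<le> i" "i \<le> n"
  shows "\<xi> i \<in> measurable (noise_filtration M N X \<xi> n) N"
proof (rule measurableI)
  fix B assume B: "B \<in> sets N"
  have "\<xi> i -` B \<inter> space M \<in> sigma_sets (space M)
     (if n = 0 then {}
      else {X -` A \<inter> space M |A. A \<in> sets borel} \<union>
           {\<xi> i -` B \<inter> space M |i B. i \<in> {1..n} \<and> B \<in> sets N})"
    by (rule sigma_sets.Basic) (use i B in auto)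
  then show "\<xi> i -` B \<inter> space (noise_filtration M N X \<xi> n) \<in> sets (noise_filtration M N X \<xi> n)"
    by (simp only: sets_noise_filtration space_noise_filtration)
qed (use measurable_space[OF \<xi>] in simp)

lemma adagrad_normD:
  assumes "adagrad_norm M sg \<xi> \<alpha>0 \<theta>1 S0 \<theta> S" and "\<omega> \<in> space M"
  shows "\<theta> 1 \<omega> = \<theta>1" and "S 0 \<omega> = S0"
    and "S (Suc n) \<omega> = S n \<omega> + (norm (sg (\<theta> (Suc n) \<omega>) (\<xi> (Suc n) \<omega>)))\<^sup>2"
    and "\<theta> (Suc (Suc n)) \<omega>
      = \<theta> (Suc n) \<omega> - (\<alpha>0 / sqrt (S (Suc n) \<omega>)) *\<^sub>R sg (\<theta> (Suc n) \<omega>) (\<xi> (Suc n) \<omega>)"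
  using assms unfolding adagrad_norm_def by (auto dest!: bspec[of _ _ \<omega>] spec[of _ "Suc n"])

lemma adagrad_norm_adapted:
  fixes M :: "'w measure" and N :: "'b measure" and \<xi> :: "nat \<Rightarrow> 'w \<Rightarrow> 'b"
    and \<theta> :: "nat \<Rightarrow> 'w \<Rightarrow> 'a::euclidean_space"
  defines "F \<equiv> noise_filtration M N (\<theta> 1) \<xi>"
  assumes adagrad: "adagrad_norm M sg \<xi> \<alpha>0 \<theta>1 S0 \<theta> S"
    and sg: "(\<lambda>(x, z). sg x z) \<in> borel_measurable (borel \<Otimes>\<^sub>M N)"
    and \<xi>: "\<And>i. i \<ge> 1 \<Longrightarrow> \<xi> i \<in> measurable M N"
  shows "subalgebra M (F n)"
    and "\<theta> (Suc n) \<in> borel_measurable (F n)" and "S n \<in> borel_measurable (F n)"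
    and "(\<lambda>\<omega>. sg (\<theta> (Suc n) \<omega>) (\<xi> (Suc n) \<omega>)) \<in> borel_measurable (F (Suc n))"
proof -
  define G where "G n \<omega> = sg (\<theta> (Suc n) \<omega>) (\<xi> (Suc n) \<omega>)" for n \<omega>
  note rec = adagrad_normD[OF adagrad, folded G_def]
  have const_\<theta>: "\<theta> 1 \<in> borel_measurable F'" if "space F' = space M" for F'
    using rec(1) that by (subst measurable_cong[where g = "\<lambda>_. \<theta>1"]) auto
  have space_F [simp]: "space (F n) = space M" for n by (simp add: F_def)
  have G_meas_step: "G n \<in> borel_measurable (F (Suc n))" if "\<theta> (Suc n) \<in> borel_measurable (F n)" for n
  proof -
    have "\<theta> (Suc n) \<in> borel_measurable (F (Suc n))"
      using measurable_from_subalg[OF subalgebra_noise_filtration_Suc] that unfolding F_def by blast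
    moreover have "\<xi> (Suc n) \<in> measurable (F (Suc n)) N"
      unfolding F_def by (intro measurable_noise_filtration \<xi>) auto
    ultimately have "(\<lambda>\<omega>. (\<theta> (Suc n) \<omega>, \<xi> (Suc n) \<omega>)) \<in> measurable (F (Suc n)) (borel \<Otimes>\<^sub>M N)"
      by (rule measurable_Pair)
    from measurable_compose[OF this sg] show ?thesis by (simp add: G_def[abs_def])
  qed
  have adapted: "\<theta> (Suc n) \<in> borel_measurable (F n) \<and> S n \<in> borel_measurable (F n)" for n
  proof (induction n)
    case 0
    have "S 0 \<in> borel_measurable (F 0)"
      using rec(2) by (subst measurable_cong[where g = "\<lambda>_. S0"]) auto
    then show ?case using const_\<theta>[of "F 0"] by simp
  next
    case (Suc n)
    have [measurable]: "\<theta> (Suc n) \<in> borel_measurable (F (Suc n))" "S n \<in> borel_measurable (F (Suc n))"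
      using measurable_from_subalg[OF subalgebra_noise_filtration_Suc] Suc unfolding F_def by blast+
    have [measurable]: "G n \<in> borel_measurable (F (Suc n))" using G_meas_step Suc by simp
    have S_meas [measurable]: "S (Suc n) \<in> borel_measurable (F (Suc n))"
      using rec(3) by (subst measurable_cong[where g = "\<lambda>\<omega>. S n \<omega> + (norm (G n \<omega>))\<^sup>2"]) auto
    have "\<theta> (Suc (Suc n)) \<in> borel_measurable (F (Suc n))"
      using rec(4)
      by (subst measurable_cong[where g = "\<lambda>\<omega>. \<theta> (Suc n) \<omega> - (\<alpha>0 / sqrt (S (Suc n) \<omega>)) *\<^sub>R G n \<omega>"]) auto
    with S_meas show ?case by simp
  qed
  show "subalgebra M (F n)"
    unfolding F_def by (intro subalgebra_noise_filtration const_\<theta> \<xi>) auto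
  show "\<theta> (Suc n) \<in> borel_measurable (F n)" "S n \<in> borel_measurable (F n)"
    using adapted by auto
  show "(\<lambda>\<omega>. sg (\<theta> (Suc n) \<omega>) (\<xi> (Suc n) \<omega>)) \<in> borel_measurable (F (Suc n))"
    using G_meas_step adapted by (simp add: G_def[abs_def])
qed

lemma adagrad_norm_S_ge:
  assumes "adagrad_norm M sg \<xi> \<alpha>0 \<theta>1 S0 \<theta> S" and "\<omega> \<in> space M"
  shows "S n \<omega> \<ge> S0"
  by (induction n) (use adagrad_normD[OF assms] in \<open>auto intro: add_increasing2\<close>)

text \<open>
The new answer is itself part of the accumulated sum, so its norm is at most \<open>sqrt (S n)\<close> and the
normalised step has length at most \<open>\<alpha>0\<close>, whatever the noise.
\<close>

lemma adagrad_norm_radius: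
  assumes adagrad: "adagrad_norm M sg \<xi> \<alpha>0 \<theta>1 S0 \<theta> S" and \<omega>: "\<omega> \<in> space M"
    and pos: "\<alpha>0 > 0" "S0 > 0"
  shows "norm (\<theta> (Suc n) \<omega> - \<theta>1) \<le> \<alpha>0 * n"
proof (induction n)
  case 0
  then show ?case using adagrad_normD(1)[OF adagrad \<omega>] by simp
next
  case (Suc n)
  define h where "h = (\<alpha>0 / sqrt (S (Suc n) \<omega>)) *\<^sub>R sg (\<theta> (Suc n) \<omega>) (\<xi> (Suc n) \<omega>)"
  note S_ge = adagrad_norm_S_ge[OF adagrad \<omega>]
  have S_pos: "S (Suc n) \<omega> > 0" using S_ge[of "Suc n"] pos by linarith
  have "(norm (sg (\<theta> (Suc n) \<omega>) (\<xi> (Suc n) \<omega>)))\<^sup>2 \<le> S (Suc n) \<omega>"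
    using adagrad_normD(3)[OF adagrad \<omega>, of n] S_ge[of n] pos by linarith
  then have "norm (sg (\<theta> (Suc n) \<omega>) (\<xi> (Suc n) \<omega>)) \<le> sqrt (S (Suc n) \<omega>)" by (rule real_le_rsqrt)
  then have "norm h \<le> \<alpha>0"
    unfolding h_def using S_pos pos by (simp add: field_simps)
  moreover have next_diff: "\<theta> (Suc (Suc n)) \<omega> - \<theta>1 = (\<theta> (Suc n) \<omega> - \<theta>1) - h"
    by (simp add: adagrad_normD(4)[OF adagrad \<omega>] h_def)
  have "norm (\<theta> (Suc (Suc n)) \<omega> - \<theta>1) \<le> norm (\<theta> (Suc n) \<omega> - \<theta>1) + norm h"
    unfolding next_diff by (rule norm_triangle_ineq4)
  moreover have "\<alpha>0 * real (Suc n) = \<alpha>0 * n + \<alpha>0" by (simp add: algebra_simps)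
  ultimately show ?case using Suc by linarith
qed

section \<open>Linear growth of the accumulated sum\<close>

theorem lemma4p3:
  fixes g :: "'a::euclidean_space \<Rightarrow> real"
    and grad :: "'a \<Rightarrow> 'a"
    and L \<alpha>0 S0 \<sigma>0 \<sigma>1 :: real
    and \<theta>1 :: 'a
    and M :: "'w measure"
    and N :: "'b measure"
    and \<xi> :: "nat \<Rightarrow> 'w \<Rightarrow> 'b"
    and sg :: "'a \<Rightarrow> 'b \<Rightarrow> 'a"
    and \<theta> :: "nat \<Rightarrow> 'w \<Rightarrow> 'a"
    and S :: "nat \<Rightarrow> 'w \<Rightarrow> real"
  assumes "\<And>x. GDERIV g x :> grad x"
    and "continuous_on UNIV grad"
    and "\<And>x. g x \<ge> 0"
    and "\<And>x y. norm (grad x - grad y) \<le> L * norm (x - y)"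
    and "prob_space M"
    and "prob_space.indep_vars M (\<lambda>_. N) \<xi> {1..}"
    and "(\<lambda>(x, z). sg x z) \<in> borel_measurable (borel \<Otimes>\<^sub>M N)"
    and "\<alpha>0 > 0"
    and "S0 > 0"
    and "adagrad_norm M sg \<xi> \<alpha>0 \<theta>1 S0 \<theta> S"
    and "\<And>n. n \<ge> 1 \<Longrightarrow>
           AE \<omega> in M. vec_cond_exp M (noise_filtration M N (\<theta> 1) \<xi> (n - 1))
                        (\<lambda>\<omega>. sg (\<theta> n \<omega>) (\<xi> n \<omega>)) \<omega> = grad (\<theta> n \<omega>)"
    and "\<sigma>0 \<ge> 0"
    and "\<sigma>1 \<ge> 0"
    and "\<And>n. n \<ge> 1 \<Longrightarrow>
           AE \<omega> in M. nn_cond_exp M (noise_filtration M N (\<theta> 1) \<xi> (n - 1))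
                        (\<lambda>\<omega>. ennreal ((norm (sg (\<theta> n \<omega>) (\<xi> n \<omega>)))\<^sup>2)) \<omega>
                      \<le> ennreal (\<sigma>0 * (norm (grad (\<theta> n \<omega>)))\<^sup>2 + \<sigma>1)"
  shows "(\<forall>T. integrable M (S T)) \<and>
         (\<lambda>T. prob_space.expectation M (S T)) \<in> O(\<lambda>T. real T)"
proof -
  interpret prob_space M by fact
  define F where "F = noise_filtration M N (\<theta> 1) \<xi>"
  define G where "G n \<omega> = sg (\<theta> (Suc n) \<omega>) (\<xi> (Suc n) \<omega>)" for n \<omega>
  (* The index n belongs to the step from iterate n + 1, so that u n, m n and S n are F n measurable. *)
  define u where "u = (\<lambda>n \<omega>. g (\<theta> (Suc n) \<omega>) + 1)"
  define m where "m = (\<lambda>n \<omega>. grad (\<theta> (Suc n) \<omega>))"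
  (* A positive Lipschitz constant is needed for the step length 1 / (2 L1). *)
  define L1 where "L1 = \<bar>L\<bar> + 1"
  have L1: "L1 > 0" unfolding L1_def by simp
  have lip: "norm (grad x - grad y) \<le> L1 * norm (x - y)" for x y
  proof -
    have "L * norm (x - y) \<le> L1 * norm (x - y)" unfolding L1_def by (intro mult_right_mono) auto
    then show ?thesis using assms(4)[of x y] by linarith
  qed
  note \<theta>_Suc = adagrad_normD(4)[OF assms(10), folded G_def]
  note S_Suc = adagrad_normD(3)[OF assms(10), folded G_def]
  note S_0 = adagrad_normD(2)[OF assms(10)]
  have \<xi>_meas: "\<xi> i \<in> measurable M N" if "i \<ge> 1" for i
    using assms(6) that unfolding indep_vars_def by auto
  have adapted: "subalgebra M (F n)" "\<theta> (Suc n) \<in> borel_measurable (F n)"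
    "S n \<in> borel_measurable (F n)" "G n \<in> borel_measurable (F (Suc n))" for n
    unfolding F_def G_def[abs_def] by (rule adagrad_norm_adapted[OF assms(10,7)]; simp add: \<xi>_meas)+
  note subalg = adapted(1)
  have g_cont: "continuous_on UNIV g"
    using assms(1) unfolding gderiv_def
    by (auto intro!: has_derivative_continuous_on simp: has_derivative_at_withinI)
  have [measurable]: "g \<in> borel_measurable borel" "grad \<in> borel_measurable borel"
    using g_cont assms(2) by (auto intro: borel_measurable_continuous_onI)
  have F_meas [measurable]: "\<theta> (Suc n) \<in> borel_measurable (F n)" "S n \<in> borel_measurable (F n)"
      "u n \<in> borel_measurable (F n)" "m n \<in> borel_measurable (F n)" for n
    using adapted(2,3)[of n] unfolding u_def m_def by auto
  have M_meas [measurable]: "\<theta> (Suc n) \<in> borel_measurable M" "S n \<in> borel_measurable M"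
      "u n \<in> borel_measurable M" "m n \<in> borel_measurable M" "G n \<in> borel_measurable M" for n
    by (rule measurable_from_subalg[OF subalg], rule F_meas adapted(4))+

  note S_ge = adagrad_norm_S_ge[OF assms(10)]
  note radius = adagrad_norm_radius[OF assms(10) _ assms(8,9)]
  have u_ge: "u n \<omega> \<ge> 1" for n \<omega> using assms(3) by (simp add: u_def)
  have m_le: "(norm (m n \<omega>))\<^sup>2 \<le> 4 * L1 * u n \<omega>" for n \<omega>
  proof -
    have "(norm (m n \<omega>))\<^sup>2 \<le> 4 * L1 * g (\<theta> (Suc n) \<omega>)"
      unfolding m_def by (rule gradient_norm_le_value[OF assms(1) lip L1 assms(3)])
    then show ?thesis using L1 by (simp add: u_def distrib_left)
  qed
  have "\<exists>r. \<forall>\<omega>\<in>space M. u n \<omega> \<le> r" for n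
  proof -
    have "compact (g ` cball \<theta>1 (\<alpha>0 * n))"
      using g_cont by (intro compact_continuous_image) (auto intro: continuous_on_subset)
    then have "bounded (g ` cball \<theta>1 (\<alpha>0 * n))" by (rule compact_imp_bounded)
    then obtain r where r: "\<And>x. x \<in> cball \<theta>1 (\<alpha>0 * n) \<Longrightarrow> \<bar>g x\<bar> \<le> r"
      unfolding bounded_iff by (metis imageI real_norm_def)
    have "u n \<omega> \<le> r + 1" if "\<omega> \<in> space M" for \<omega>
      using r[of "\<theta> (Suc n) \<omega>"] radius[OF that, of n] by (simp add: u_def dist_norm norm_minus_commute)
    then show ?thesis by blast
  qed
  then obtain r where u_le: "\<And>n \<omega>. \<omega> \<in> space M \<Longrightarrow> u n \<omega> \<le> r n" by metis

  (* The drift inequality divides by sigma0 * eta + sigma1, hence sigma1 + 1 in place of sigma1. *)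
  obtain c K R Z1 Z2 where cKR: "c \<ge> 0" "K \<ge> 0" "R \<ge> 0"
    and Z_meas: "(\<lambda>(S, u, \<eta>). Z1 S u \<eta>) \<in> borel_measurable borel"
      "(\<lambda>(S, u, \<eta>). Z2 S u \<eta>) \<in> borel_measurable borel"
    and Z1_bound: "\<And>S u \<eta>. S \<ge> S0 \<Longrightarrow> u \<ge> 1 \<Longrightarrow> \<eta> \<ge> 0 \<Longrightarrow> \<bar>Z1 S u \<eta>\<bar> \<le> R * u ^ 4"
    and Z2_bound: "\<And>S u \<eta>. S \<ge> S0 \<Longrightarrow> u \<ge> 1 \<Longrightarrow> \<eta> \<ge> 0 \<Longrightarrow> 0 \<le> Z2 S u \<eta> \<and> Z2 S u \<eta> \<le> R * u ^ 4"
    and drift: "\<And>S u \<eta> \<Gamma> p v. \<lbrakk>S \<ge> S0; u \<ge> 1; \<eta> \<ge> 0; \<eta> \<le> (4 * L1) * u; \<Gamma> \<ge> 0; p\<^sup>2 \<le> \<eta> * \<Gamma>;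
      \<bar>v - u + \<alpha>0 * (p / sqrt (S + \<Gamma>))\<bar> \<le> (L1 * \<alpha>0\<^sup>2) * (\<Gamma> / (S + \<Gamma>))\<rbrakk> \<Longrightarrow>
      sqrt (S + \<Gamma>) * v + c * (v ^ 4 + K) / (S + \<Gamma>) \<le> sqrt S * u + c * (u ^ 4 + K) / S
        - \<alpha>0 / 2 * \<eta> + R + Z1 S u \<eta> * (\<eta> - p) + Z2 S u \<eta> * (\<Gamma> - (\<sigma>0 * \<eta> + (\<sigma>1 + 1)))"
    by (rule adagrad_lyapunov_drift[of \<alpha>0 "L1 * \<alpha>0\<^sup>2" "4 * L1" \<sigma>0 "\<sigma>1 + 1" S0])
      (use assms L1 in auto)
  define \<eta> where "\<eta> = (\<lambda>n \<omega>. (norm (m n \<omega>))\<^sup>2)"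
  define \<Gamma> where "\<Gamma> = (\<lambda>n \<omega>. (norm (G n \<omega>))\<^sup>2)"
  define \<rho> where "\<rho> = (\<lambda>n \<omega>. \<sigma>0 * \<eta> n \<omega> + (\<sigma>1 + 1))"
  define Y1 where "Y1 = (\<lambda>n \<omega>. Z1 (S n \<omega>) (u n \<omega>) (\<eta> n \<omega>))"
  define Y2 where "Y2 = (\<lambda>n \<omega>. Z2 (S n \<omega>) (u n \<omega>) (\<eta> n \<omega>))"
  define W where "W = (\<lambda>n \<omega>. sqrt (S n \<omega>) * u n \<omega> + c * (u n \<omega> ^ 4 + K) / S n \<omega>)"
  have drift_path: "W (Suc n) \<omega> \<le> W n \<omega> - \<alpha>0 / 2 * \<eta> n \<omega> + R
      + Y1 n \<omega> * (\<eta> n \<omega> - m n \<omega> \<bullet> G n \<omega>) + Y2 n \<omega> * (\<Gamma> n \<omega> - \<rho> n \<omega>)" if \<omega>: "\<omega> \<in> space M" for n \<omega>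
  proof -
    have S: "S (Suc n) \<omega> = S n \<omega> + \<Gamma> n \<omega>" using S_Suc[OF \<omega>] by (simp add: \<Gamma>_def)
    have pos: "S (Suc n) \<omega> > 0" using S_ge[OF \<omega>, of "Suc n"] assms(9) by linarith
    have cs: "(m n \<omega> \<bullet> G n \<omega>)\<^sup>2 \<le> \<eta> n \<omega> * \<Gamma> n \<omega>"
      using Cauchy_Schwarz_ineq[of "m n \<omega>" "G n \<omega>"] by (simp add: \<eta>_def \<Gamma>_def power2_norm_eq_inner)
    let ?h = "- (\<alpha>0 / sqrt (S (Suc n) \<omega>)) *\<^sub>R G n \<omega>"
    have next_u: "g (\<theta> (Suc n) \<omega> + ?h) = u (Suc n) \<omega> - 1"
      using \<theta>_Suc[OF \<omega>, of n] by (simp add: u_def)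
    have "\<bar>g (\<theta> (Suc n) \<omega> + ?h) - g (\<theta> (Suc n) \<omega>) - grad (\<theta> (Suc n) \<omega>) \<bullet> ?h\<bar> \<le> L1 * (norm ?h)\<^sup>2"
      by (rule gradient_lipschitz_remainder[OF assms(1) lip]) (use L1 in auto)
    also have "L1 * (norm ?h)\<^sup>2 = L1 * \<alpha>0\<^sup>2 * (\<Gamma> n \<omega> / S (Suc n) \<omega>)"
      using pos by (simp add: \<Gamma>_def power_mult_distrib power_divide)
    also have "g (\<theta> (Suc n) \<omega> + ?h) - g (\<theta> (Suc n) \<omega>) - grad (\<theta> (Suc n) \<omega>) \<bullet> ?h
        = u (Suc n) \<omega> - u n \<omega> + \<alpha>0 * (m n \<omega> \<bullet> G n \<omega> / sqrt (S (Suc n) \<omega>))"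
      unfolding next_u by (simp add: u_def m_def)
    finally show ?thesis
      unfolding W_def Y1_def Y2_def \<rho>_def S
      using S_ge[OF \<omega>, of n] u_ge m_le[of n \<omega>] cs
      by (intro drift) (auto simp: \<eta>_def \<Gamma>_def)
  qed

  have \<eta>_nonneg: "\<eta> n \<omega> \<ge> 0" and \<Gamma>_nonneg: "\<Gamma> n \<omega> \<ge> 0" for n \<omega> by (auto simp: \<eta>_def \<Gamma>_def)
  have \<eta>_le: "\<eta> n \<omega> \<le> 4 * L1 * r n" if "\<omega> \<in> space M" for n \<omega>
  proof -
    have "4 * L1 * u n \<omega> \<le> 4 * L1 * r n" using u_le[OF that, of n] L1 by (intro mult_left_mono) auto
    then show ?thesis using m_le[of n \<omega>] by (simp add: \<eta>_def)
  qed
  have Y_meas: "Y1 n \<in> borel_measurable (F n)" "Y2 n \<in> borel_measurable (F n)" for n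
  proof -
    have "(\<lambda>\<omega>. (S n \<omega>, u n \<omega>, \<eta> n \<omega>)) \<in> borel_measurable (F n)" unfolding \<eta>_def by measurable
    from measurable_compose[OF this Z_meas(1)] measurable_compose[OF this Z_meas(2)]
    show "Y1 n \<in> borel_measurable (F n)" "Y2 n \<in> borel_measurable (F n)"
      by (simp_all add: Y1_def Y2_def)
  qed
  have Y_bound: "\<bar>Y1 n \<omega>\<bar> \<le> R * r n ^ 4" "0 \<le> Y2 n \<omega> \<and> Y2 n \<omega> \<le> R * r n ^ 4"
    if \<omega>: "\<omega> \<in> space M" for n \<omega>
  proof -
    have "R * u n \<omega> ^ 4 \<le> R * r n ^ 4"
      using u_ge[of n \<omega>] u_le[OF \<omega>, of n] cKR by (intro mult_left_mono power_mono) auto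
    then show "\<bar>Y1 n \<omega>\<bar> \<le> R * r n ^ 4" "0 \<le> Y2 n \<omega> \<and> Y2 n \<omega> \<le> R * r n ^ 4"
      using Z1_bound[of "S n \<omega>" "u n \<omega>" "\<eta> n \<omega>"] Z2_bound[of "S n \<omega>" "u n \<omega>" "\<eta> n \<omega>"]
        S_ge[OF \<omega>, of n] u_ge[of n \<omega>] \<eta>_nonneg[of n \<omega>]
      unfolding Y1_def Y2_def by linarith+
  qed

  have second_moment: "integrable M (\<Gamma> n)"
    "integrable M (\<lambda>\<omega>. Y \<omega> * \<Gamma> n \<omega>)" "integrable M (\<lambda>\<omega>. Y \<omega> * \<rho> n \<omega>)"
    "expectation (\<lambda>\<omega>. Y \<omega> * \<Gamma> n \<omega>) \<le> expectation (\<lambda>\<omega>. Y \<omega> * \<rho> n \<omega>)"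
    if "Y \<in> borel_measurable (F n)" "\<And>\<omega>. \<omega> \<in> space M \<Longrightarrow> 0 \<le> Y \<omega> \<and> Y \<omega> \<le> b" for n b Y
  proof -
    interpret finite_measure_subalgebra M "F n" by unfold_locales (rule subalg)
    have "ennreal (\<sigma>0 * \<eta> n \<omega> + \<sigma>1) \<le> ennreal (\<rho> n \<omega>)" for \<omega>
      unfolding \<rho>_def by (intro ennreal_leI) simp
    moreover have "AE \<omega> in M. nn_cond_exp M (F n) (\<lambda>\<omega>. ennreal (\<Gamma> n \<omega>)) \<omega> \<le> ennreal (\<sigma>0 * \<eta> n \<omega> + \<sigma>1)"
      using assms(14)[of "Suc n"] unfolding F_def \<Gamma>_def G_def \<eta>_def m_def by simp
    ultimately have bound: "AE \<omega> in M. nn_cond_exp M (F n) (\<lambda>\<omega>. ennreal (\<Gamma> n \<omega>)) \<omega> \<le> ennreal (\<rho> n \<omega>)"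
      by (auto elim!: eventually_mono intro: order_trans)
    have \<rho>_bound: "0 \<le> \<rho> n \<omega> \<and> \<rho> n \<omega> \<le> \<sigma>0 * (4 * L1 * r n) + (\<sigma>1 + 1)" if "\<omega> \<in> space M" for \<omega>
      unfolding \<rho>_def using \<eta>_nonneg[of n \<omega>] \<eta>_le[OF that, of n] assms(12,13) by (auto intro!: mult_left_mono)
    have meas: "\<Gamma> n \<in> borel_measurable M" "\<rho> n \<in> borel_measurable (F n)"
      unfolding \<Gamma>_def \<rho>_def \<eta>_def by measurable
    note * = integral_cond_bound[OF meas(1) \<Gamma>_nonneg meas(2) \<rho>_bound bound that]
    show "integrable M (\<Gamma> n)"
      "integrable M (\<lambda>\<omega>. Y \<omega> * \<Gamma> n \<omega>)" "integrable M (\<lambda>\<omega>. Y \<omega> * \<rho> n \<omega>)"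
      "expectation (\<lambda>\<omega>. Y \<omega> * \<Gamma> n \<omega>) \<le> expectation (\<lambda>\<omega>. Y \<omega> * \<rho> n \<omega>)"
      by (rule *; assumption)+
  qed
  (* The test function 1 already gives the unweighted second moments. *)
  have \<Gamma>_int: "integrable M (\<Gamma> n)" and \<Gamma>_le: "expectation (\<Gamma> n) \<le> expectation (\<rho> n)" for n
    using second_moment(1)[of "\<lambda>_. 1" n 1] second_moment(4)[of "\<lambda>_. 1" n 1] by auto
  have S_int: "integrable M (S n)" for n
  proof (induction n)
    case 0
    show ?case using S_0 by (subst Bochner_Integration.integrable_cong[where g = "\<lambda>_. S0"]) auto
  next
    case (Suc n)
    then show ?case using S_Suc \<Gamma>_int[of n]
      by (subst Bochner_Integration.integrable_cong[where g = "\<lambda>\<omega>. S n \<omega> + \<Gamma> n \<omega>"]) (auto simp: \<Gamma>_def)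
  qed
  have \<eta>_int: "integrable M (\<eta> n)" for n
    using \<eta>_nonneg \<eta>_le by (intro integrable_const_bound[where B = "4 * L1 * r n"] AE_I2) (auto simp: \<eta>_def)
  have W_nonneg: "W n \<omega> \<ge> 0" if "\<omega> \<in> space M" for n \<omega>
    unfolding W_def using cKR u_ge[of n \<omega>] S_ge[OF that, of n] assms(9) by auto
  (* sqrt (S n) is the only factor of W n without a deterministic bound. *)
  have W_int: "integrable M (W n)" for n
  proof (rule Bochner_Integration.integrable_bound)
    show "integrable M (\<lambda>\<omega>. (1 + S n \<omega>) * r n + c * (r n ^ 4 + K) / S0)" using S_int by auto
    have "norm (W n \<omega>) \<le> norm ((1 + S n \<omega>) * r n + c * (r n ^ 4 + K) / S0)" if \<omega>: "\<omega> \<in> space M" for \<omega>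
    proof -
      have S: "S n \<omega> \<ge> S0" "S n \<omega> > 0" using S_ge[OF \<omega>, of n] assms(9) by auto
      have "sqrt (S n \<omega>) \<le> 1 + S n \<omega>"
        using S sum_squares_bound[of 1 "sqrt (S n \<omega>)"] by (simp add: real_le_lsqrt power2_eq_square algebra_simps)
      then have "sqrt (S n \<omega>) * u n \<omega> \<le> (1 + S n \<omega>) * r n"
        using S u_ge[of n \<omega>] u_le[OF \<omega>, of n] by (intro mult_mono) auto
      moreover have "c * (u n \<omega> ^ 4 + K) / S n \<omega> \<le> c * (r n ^ 4 + K) / S0"
        using S u_ge[of n \<omega>] u_le[OF \<omega>, of n] cKR assms(9)
        by (intro frac_le mult_left_mono add_right_mono power_mono mult_nonneg_nonneg add_nonneg_nonneg) auto
      ultimately have "W n \<omega> \<le> (1 + S n \<omega>) * r n + c * (r n ^ 4 + K) / S0" unfolding W_def by linarith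
      then show ?thesis using W_nonneg[OF \<omega>, of n] by simp
    qed
    then show "AE \<omega> in M. norm (W n \<omega>) \<le> norm ((1 + S n \<omega>) * r n + c * (r n ^ 4 + K) / S0)"
      by (intro AE_I2)
    show "W n \<in> borel_measurable M" unfolding W_def by measurable
  qed

  have drift_exp: "\<alpha>0 / 2 * expectation (\<eta> n) \<le> expectation (W n) - expectation (W (Suc n)) + R" for n
  proof -
    interpret finite_measure_subalgebra M "F n" by unfold_locales (rule subalg)
    have m_bound: "norm (m n \<omega>) \<le> sqrt (4 * L1 * r n)" if "\<omega> \<in> space M" for \<omega>
      using \<eta>_le[OF that, of n] by (intro real_le_rsqrt) (simp add: \<eta>_def)
    have mean: "AE \<omega> in M. vec_cond_exp M (F n) (G n) \<omega> = m n \<omega>"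
      using assms(11)[of "Suc n"] unfolding F_def G_def[abs_def] m_def by simp
    have G_int: "integrable M (\<lambda>\<omega>. (norm (G n \<omega>))\<^sup>2)" using \<Gamma>_int[of n] by (simp add: \<Gamma>_def)
    note first = integral_cond_mean[OF M_meas(5) G_int F_meas(4) m_bound mean Y_meas(1) Y_bound(1), folded \<eta>_def]
    note second = second_moment[OF Y_meas(2) Y_bound(2)]
    have "expectation (W (Suc n)) \<le> expectation (\<lambda>\<omega>. W n \<omega> - \<alpha>0 / 2 * \<eta> n \<omega> + R
        + (Y1 n \<omega> * \<eta> n \<omega> - Y1 n \<omega> * (m n \<omega> \<bullet> G n \<omega>)) + (Y2 n \<omega> * \<Gamma> n \<omega> - Y2 n \<omega> * \<rho> n \<omega>))"
    proof (rule integral_mono)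
      show "integrable M (\<lambda>\<omega>. W n \<omega> - \<alpha>0 / 2 * \<eta> n \<omega> + R
        + (Y1 n \<omega> * \<eta> n \<omega> - Y1 n \<omega> * (m n \<omega> \<bullet> G n \<omega>)) + (Y2 n \<omega> * \<Gamma> n \<omega> - Y2 n \<omega> * \<rho> n \<omega>))"
        using W_int \<eta>_int first(1,2) second(2,3) by (auto simp: \<eta>_def)
    qed (use W_int drift_path in \<open>auto simp: right_diff_distrib\<close>)
    also have "\<dots> = expectation (W n) - \<alpha>0 / 2 * expectation (\<eta> n) + R
        + (expectation (\<lambda>\<omega>. Y1 n \<omega> * \<eta> n \<omega>) - expectation (\<lambda>\<omega>. Y1 n \<omega> * (m n \<omega> \<bullet> G n \<omega>)))
        + (expectation (\<lambda>\<omega>. Y2 n \<omega> * \<Gamma> n \<omega>) - expectation (\<lambda>\<omega>. Y2 n \<omega> * \<rho> n \<omega>))"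
      using W_int \<eta>_int first(1,2) second(2,3) by (simp add: \<eta>_def prob_space)
    also have "\<dots> \<le> expectation (W n) - \<alpha>0 / 2 * expectation (\<eta> n) + R"
      using first(3) second(4) by (simp add: \<eta>_def)
    finally show ?thesis by linarith
  qed

  define a where "a = S0 + \<sigma>0 * (2 / \<alpha>0 * expectation (W 0))"
  define b where "b = \<sigma>0 * (2 / \<alpha>0 * R) + (\<sigma>1 + 1)"
  have "\<alpha>0 / 2 * (\<Sum>k<T. expectation (\<eta> k)) \<le> expectation (W 0) - expectation (W T) + R * T" for T
  proof (induction T)
    case (Suc T)
    then show ?case using drift_exp[of T] by (simp add: distrib_left)
  qed simp
  moreover have "expectation (W T) \<ge> 0" for T
    using W_nonneg by (intro integral_nonneg_AE AE_I2)
  ultimately have "\<alpha>0 / 2 * (\<Sum>k<T. expectation (\<eta> k)) \<le> expectation (W 0) + R * T" for T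
    by (smt (verit))
  then have grad_sum: "(\<Sum>k<T. expectation (\<eta> k)) \<le> 2 / \<alpha>0 * (expectation (W 0) + R * T)" for T
    using assms(8) by (simp add: field_simps)
  have S_le: "expectation (S T) \<le> S0 + (\<sigma>0 * (\<Sum>k<T. expectation (\<eta> k)) + (\<sigma>1 + 1) * T)" for T
  proof (induction T)
    case 0
    have "expectation (S 0) = expectation (\<lambda>_. S0)"
      using S_0 by (intro Bochner_Integration.integral_cong) auto
    then show ?case by (simp add: prob_space)
  next
    case (Suc T)
    have "expectation (S (Suc T)) = expectation (\<lambda>\<omega>. S T \<omega> + \<Gamma> T \<omega>)"
      using S_Suc by (intro Bochner_Integration.integral_cong) (auto simp: \<Gamma>_def)
    also have "\<dots> = expectation (S T) + expectation (\<Gamma> T)" using S_int \<Gamma>_int by simp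
    also have "expectation (\<Gamma> T) \<le> \<sigma>0 * expectation (\<eta> T) + (\<sigma>1 + 1)"
      using \<Gamma>_le[of T] \<eta>_int[of T] by (simp add: \<rho>_def prob_space)
    finally show ?case using Suc by (simp add: algebra_simps)
  qed
  have linear_bound: "expectation (S T) \<le> a + b * T" for T
  proof -
    have "\<sigma>0 * (\<Sum>k<T. expectation (\<eta> k)) \<le> \<sigma>0 * (2 / \<alpha>0 * (expectation (W 0) + R * T))"
      using grad_sum assms(12) by (intro mult_left_mono)
    then show ?thesis using S_le[of T] unfolding a_def b_def by (simp add: algebra_simps)
  qed
  have "(\<lambda>T. expectation (S T)) \<in> O(\<lambda>T. real T)"
  proof (rule bigoI[where c = "\<bar>a\<bar> + b"])
    have "norm (expectation (S T)) \<le> (\<bar>a\<bar> + b) * norm (real T)" if "T \<ge> 1" for T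
    proof -
      have "0 \<le> S T \<omega>" if "\<omega> \<in> space M" for \<omega> using S_ge[OF that, of T] assms(9) by linarith
      then have "expectation (S T) \<ge> 0" by (intro integral_nonneg_AE AE_I2)
      moreover have "a \<le> \<bar>a\<bar> * T" using that mult_left_mono[of 1 "real T" "\<bar>a\<bar>"] by auto
      ultimately show ?thesis using linear_bound[of T] by (simp add: distrib_right)
    qed
    then show "\<forall>\<^sub>F T in sequentially. norm (expectation (S T)) \<le> (\<bar>a\<bar> + b) * norm (real T)"
      unfolding eventually_sequentially by blast
  qed
  with S_int show ?thesis by blast
qed

end
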